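(* Let $\delta>0$, $\mu>0$, $0\le\theta\le 1$ and $-1/2<\nu<1$. Let $f=f(v,I)\ge 0$ be a measurable function on $\mathbb{R}^3\times\mathbb{R}^+$ such that $(1+|v|^2+I^{2/\delta})f$, $f\ln f$ and $\mathcal{M}_{\nu,\theta}(f)\ln f$ are integrable, with $\rho>0$, $T_{tr}>0$, $T_{int}>0$ (quantities, Gaussians and functionals as defined in the context). Then the entropy production functional $D_{\nu,\theta}(f)$ satisfies: (1) if $0<\theta\le 1$, then $$D_{\nu,\theta}(f)\ \ge\ \theta\, A_{\nu,\theta}\, H(f|\mathcal{M}_{0,1});$$ (2) if $\theta=0$, then $$D_{\nu,0}(f)\ \ge\ \min\{1-\nu,\,1+2\nu\}\, A_{\nu,0}\, H(f|\mathcal{M}_{0,0}).$$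
   Context: $\mathbb{R}^+=[0,\infty)$. In general the distribution function is $f(t,x,v,I)$, with $v\in\mathbb{R}^3$ and $I\ge 0$; here $(t,x)$ is a fixed parameter and all integrals are over $(v,I)\in\mathbb{R}^3\times\mathbb{R}^+$. Conventions: $0\ln 0=0$ in $f\ln f$, and $\ln 0=-\infty$ otherwise (so integrability of $\mathcal{M}_{\nu,\theta}(f)\ln f$ entails $f>0$ a.e.). Macroscopic quantities of $f$: $$\rho=\int f\,dv\,dI,\quad U=\frac1\rho\int v f\,dv\,dI,\quad \Theta=\frac1\rho\int (v-U)\otimes(v-U)f\,dv\,dI,$$ $$E_{\delta}=\frac1\rho\int\Big(\tfrac12|v-U|^2+I^{2/\delta}\Big)f\,dv\,dI,\quad E_{tr}=\frac1\rho\int\tfrac12|v-U|^2f\,dv\,dI,\quad E_{int}=\frac1\rho\int I^{2/\delta}f\,dv\,dI.$$ Temperatures $T_\delta,T_{tr},T_{int}$ are defined by $E_\delta=\frac{3+\delta}{2}T_\delta$, $E_{tr}=\frac32T_{tr}$, $E_{int}=\frac\delta2T_{int}$. Further, $$T_\theta=\theta T_\delta+(1-\theta)T_{int},\qquad \mathcal{T}_{\nu,\theta}=\theta T_\delta\, Id+(1-\theta)\{(1-\nu)T_{tr}\,Id+\nu\Theta\},$$ $$A_{\nu,\theta}=\frac{\rho T_\delta}{\mu(1-\nu+\theta\nu)},\qquad \Lambda_\delta=\Big(\int_{\mathbb{R}^+}e^{-I^{2/\delta}}dI\Big)^{-1}.$$ The polyatomic ellipsoidal Gaussian is $$\mathcal{M}_{\nu,\theta}(f)=\frac{\rho\Lambda_\delta}{\sqrt{\det(2\pi\mathcal{T}_{\nu,\theta})}\,T_\theta^{\delta/2}}\exp\Big(-\tfrac12(v-U)^\top\mathcal{T}_{\nu,\theta}^{-1}(v-U)-\frac{I^{2/\delta}}{T_\theta}\Big).$$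 In particular (computed from the same $f$) $$\mathcal{M}_{0,1}=\frac{\rho\Lambda_\delta}{(2\pi T_\delta)^{3/2}T_\delta^{\delta/2}}\exp\Big(-\frac{|v-U|^2}{2T_\delta}-\frac{I^{2/\delta}}{T_\delta}\Big),\qquad \mathcal{M}_{0,0}=\frac{\rho\Lambda_\delta}{(2\pi T_{tr})^{3/2}T_{int}^{\delta/2}}\exp\Big(-\frac{|v-U|^2}{2T_{tr}}-\frac{I^{2/\delta}}{T_{int}}\Big).$$ Functionals: $$H(f|g)=\int f\ln(f/g)\,dv\,dI,\qquad D_{\nu,\theta}(f)=-\int A_{\nu,\theta}\{\mathcal{M}_{\nu,\theta}(f)-f\}\ln f\,dv\,dI.$$ *)

theory Defs
  imports "HOL-Analysis.Analysis"
begin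

text \<open>
  Points of the phase space are pairs \<open>(v, I)\<close>. Functions are total on \<open>(real^3) \<times> real\<close>, and only
  their restriction to \<open>I \<ge> 0\<close> matters. The power \<open>I\<close> to the \<open>2/\<delta>\<close> is \<open>I powr (2/\<delta>)\<close>, which is
  \<open>0\<close> at \<open>I = 0\<close> as it should be.
\<close>

definition phase :: "((real^3) \<times> real) measure" where
  "phase = lebesgue_on (UNIV \<times> {0..})"

definition rho :: "((real^3) \<times> real \<Rightarrow> real) \<Rightarrow> real" where
  "rho f = (LINT (v, I)|phase. f (v, I))"

definition U :: "((real^3) \<times> real \<Rightarrow> real) \<Rightarrow> real^3" where
  "U f = (1 / rho f) *\<^sub>R (LINT (v, I)|phase. f (v, I) *\<^sub>R v)"

definition outer :: "real^3 \<Rightarrow> real^3 \<Rightarrow> real^3^3" where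
  "outer a b = (\<chi> i j. a $ i * b $ j)"

definition Theta :: "((real^3) \<times> real \<Rightarrow> real) \<Rightarrow> real^3^3" where
  "Theta f = (1 / rho f) *\<^sub>R (LINT (v, I)|phase. f (v, I) *\<^sub>R outer (v - U f) (v - U f))"

definition E_tot :: "real \<Rightarrow> ((real^3) \<times> real \<Rightarrow> real) \<Rightarrow> real" where
  "E_tot \<delta> f =
     (1 / rho f) * (LINT (v, I)|phase. ((norm (v - U f))\<^sup>2 / 2 + I powr (2 / \<delta>)) * f (v, I))"

definition E_tr :: "((real^3) \<times> real \<Rightarrow> real) \<Rightarrow> real" where
  "E_tr f = (1 / rho f) * (LINT (v, I)|phase. (norm (v - U f))\<^sup>2 / 2 * f (v, I))"

definition E_int :: "real \<Rightarrow> ((real^3) \<times> real \<Rightarrow> real) \<Rightarrow> real" where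
  "E_int \<delta> f = (1 / rho f) * (LINT (v, I)|phase. I powr (2 / \<delta>) * f (v, I))"

text \<open>The temperatures solve \<open>E_tot = (3 + \<delta>)/2 T_tot\<close>, \<open>E_tr = 3/2 T_tr\<close>, \<open>E_int = \<delta>/2 T_int\<close>;
  \<open>E_tot\<close> and \<open>T_tot\<close> are the quantities with index \<open>\<delta>\<close>.\<close>

definition T_tot :: "real \<Rightarrow> ((real^3) \<times> real \<Rightarrow> real) \<Rightarrow> real" where
  "T_tot \<delta> f = 2 / (3 + \<delta>) * E_tot \<delta> f"

definition T_tr :: "((real^3) \<times> real \<Rightarrow> real) \<Rightarrow> real" where
  "T_tr f = 2 / 3 * E_tr f"

definition T_int :: "real \<Rightarrow> ((real^3) \<times> real \<Rightarrow> real) \<Rightarrow> real" where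
  "T_int \<delta> f = 2 / \<delta> * E_int \<delta> f"

definition T_relax :: "real \<Rightarrow> real \<Rightarrow> ((real^3) \<times> real \<Rightarrow> real) \<Rightarrow> real" where
  "T_relax \<delta> \<theta> f = \<theta> * T_tot \<delta> f + (1 - \<theta>) * T_int \<delta> f"

definition T_tensor :: "real \<Rightarrow> real \<Rightarrow> real \<Rightarrow> ((real^3) \<times> real \<Rightarrow> real) \<Rightarrow> real^3^3" where
  "T_tensor \<delta> \<nu> \<theta> f =
     (\<theta> * T_tot \<delta> f) *\<^sub>R mat 1
     + (1 - \<theta>) *\<^sub>R (((1 - \<nu>) * T_tr f) *\<^sub>R mat 1 + \<nu> *\<^sub>R Theta f)"

definition A_coef :: "real \<Rightarrow> real \<Rightarrow> real \<Rightarrow> real \<Rightarrow> ((real^3) \<times> real \<Rightarrow> real) \<Rightarrow> real" where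
  "A_coef \<delta> \<mu> \<nu> \<theta> f = rho f * T_tot \<delta> f / (\<mu> * (1 - \<nu> + \<theta> * \<nu>))"

definition Lambda :: "real \<Rightarrow> real" where
  "Lambda \<delta> = inverse (LINT I|lebesgue_on {0..}. exp (- (I powr (2 / \<delta>))))"

definition gaussian ::
  "real \<Rightarrow> real \<Rightarrow> real \<Rightarrow> ((real^3) \<times> real \<Rightarrow> real) \<Rightarrow> (real^3) \<times> real \<Rightarrow> real" where
  "gaussian \<delta> \<nu> \<theta> f = (\<lambda>(v, I).
     rho f * Lambda \<delta>
       / (sqrt (det ((2 * pi) *\<^sub>R T_tensor \<delta> \<nu> \<theta> f)) * T_relax \<delta> \<theta> f powr (\<delta> / 2))
     * exp (- (1 / 2) * ((v - U f) \<bullet> (matrix_inv (T_tensor \<delta> \<nu> \<theta> f) *v (v - U f)))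
            - I powr (2 / \<delta>) / T_relax \<delta> \<theta> f))"

text \<open>
  The logarithm with \<open>ln 0 = -\<infinity>\<close>. In \<^typ>\<open>ereal\<close> one has \<open>0 * (-\<infinity>) = 0\<close>, so \<open>0 ln 0 = 0\<close>, while
  \<open>g ln f = -\<infinity>\<close> where \<open>g > 0\<close> and \<open>f = 0\<close>. Integrability of \<open>g ln f\<close> in the sense below therefore
  forces \<open>f > 0\<close> almost everywhere on \<open>{g > 0}\<close>.
\<close>

definition ext_ln :: "real \<Rightarrow> ereal" where
  "ext_ln x = (if x = 0 then -\<infinity> else ereal (ln x))"

definition ext_integrable :: "'a measure \<Rightarrow> ('a \<Rightarrow> ereal) \<Rightarrow> bool" where
  "ext_integrable M F \<longleftrightarrow> F \<in> borel_measurable M \<and> (\<integral>\<^sup>+ x. e2ennreal \<bar>F x\<bar> \<partial>M) < \<infinity>"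

text \<open>
  The functionals use the real logarithm, for which \<open>ln 0 = 0\<close>. In \<open>rel_entropy\<close> the integrand
  vanishes where \<open>f = 0\<close>, as required by \<open>0 ln 0 = 0\<close>. In \<open>entropy_production\<close> the value of the
  integrand where \<open>f = 0\<close> is irrelevant as soon as \<open>gaussian \<delta> \<nu> \<theta> f\<close> is positive and its product
  with \<open>ext_ln \<circ> f\<close> is \<open>ext_integrable\<close>, since \<open>{f = 0}\<close> is then a null set.
\<close>

definition rel_entropy ::
  "((real^3) \<times> real \<Rightarrow> real) \<Rightarrow> ((real^3) \<times> real \<Rightarrow> real) \<Rightarrow> real" where
  "rel_entropy f g = (LINT z|phase. f z * ln (f z / g z))"

definition entropy_production ::
  "real \<Rightarrow> real \<Rightarrow> real \<Rightarrow> real \<Rightarrow> ((real^3) \<times> real \<Rightarrow> real) \<Rightarrow> real" where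
  "entropy_production \<delta> \<mu> \<nu> \<theta> f =
     - (LINT z|phase. A_coef \<delta> \<mu> \<nu> \<theta> f * (gaussian \<delta> \<nu> \<theta> f z - f z) * ln (f z))"

end

theory Submission
  imports Defs "HOL-Probability.Distributions" "HOL-Probability.Sinc_Integral"
    "HOL-Real_Asymp.Real_Asymp"
begin

text \<open>
  Write \<open>M\<close> for the ellipsoidal Gaussian and \<open>H(g)\<close> for the integral of \<open>g ln g\<close>. Since \<open>M\<close> and
  \<open>f\<close> have the same mass, the Gibbs inequality bounds the integral of \<open>M ln f\<close> by \<open>H(M)\<close>, so that
  the entropy production is at least \<open>A (H(f) - H(M))\<close>. What is left
  is a comparison of \<open>H(f)\<close> with the entropies of Gaussians, and these are explicit.

  Diagonalise the pressure tensor \<open>Theta f\<close> in an orthonormal frame, with eigenvalues \<open>l i\<close>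
  (\<open>symmetric_matrix_eigenframe\<close>); they are positive because \<open>f\<close>, being a function, does not
  concentrate on a hyperplane (\<open>Theta_pos_def\<close>). Every tensor \<open>T_tensor\<close> is diagonal in the same
  frame, so every Gaussian in question is a product of one-dimensional normal densities and of a
  density in \<open>I\<close> (\<open>gaussian_eq_frame_maxwellian\<close>). A Gaussian with directional temperatures \<open>t i\<close>
  and internal temperature \<open>T\<close> has \<open>H = rho (k - X)\<close> with a common constant \<open>k\<close> and
  \<open>X = (1/2) \<Sum>i. ln (t i) + (\<delta>/2) ln T\<close>. Two further facts follow from
  \<open>cross_entropy_frame_maxwellian\<close>, as the logarithm of a Gaussian only sees second moments: the
  relative entropy of \<open>f\<close> with respect to an isotropic Gaussian with matching energy is a
  difference of entropies, and, again by Gibbs, \<open>H(f)\<close> is at least the entropy of the Gaussian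
  with the full tensor \<open>Theta f\<close> and internal temperature \<open>T_int\<close>.

  Hence both claims have the form: if \<open>H(f) \<ge> rho (k - X)\<close>, then
  \<open>H(f) - rho (k - Y) \<ge> w (H(f) - rho (k - Z))\<close>, which holds as soon as
  \<open>Y \<ge> w Z + (1 - w) X\<close> (\<open>entropy_interpolation\<close>). Here \<open>X\<close>, \<open>Y\<close>, \<open>Z\<close> belong to \<open>Theta f\<close>, to \<open>M\<close>
  and to the isotropic Gaussian. For \<open>\<theta> = 0\<close> and \<open>w = min (1 - \<nu>) (1 + 2 \<nu>)\<close> this is
  \<open>sum_ln_relaxed_eigenvalues\<close>: each eigenvalue of the tensor of \<open>M\<close> is a convex combination of
  \<open>T_tr\<close> with weight \<open>w\<close> and of eigenvalues of \<open>Theta f\<close>, and \<open>ln\<close> is concave. For \<open>\<theta> > 0\<close> and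
  \<open>w = \<theta>\<close> it follows from the concavity of \<open>ln\<close> along the mixtures with \<open>\<theta> T_tot\<close>, from the same
  inequality, and from the inequality of the arithmetic and geometric means.
\<close>

section \<open>Eigenframes of symmetric matrices\<close>

text \<open>
  A maximiser \<open>x\<close> of the Rayleigh quotient over the unit sphere of \<open>S\<close> is an eigenvector. To first
  order, moving from \<open>x\<close> towards some \<open>y \<in> S\<close> orthogonal to \<open>x\<close> cannot increase the quotient, so
  \<open>f x\<close> is orthogonal to every such \<open>y\<close>, in particular to its own component orthogonal to \<open>x\<close>.
\<close>

lemma self_adjoint_has_eigenvector:
  fixes f :: "'a::euclidean_space \<Rightarrow> 'a"
  assumes f: "linear f" and sa: "\<And>x y. x \<bullet> f y = f x \<bullet> y"
    and S: "subspace S" "f ` S \<subseteq> S" "dim S \<noteq> 0"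
  obtains x l where "x \<in> S" "norm x = 1" "f x = l *\<^sub>R x"
proof -
  have cf: "continuous_on T f" for T
    using f linear_continuous_on linear_conv_bounded_linear by blast
  obtain w where w: "w \<in> S" "w \<noteq> 0"
    using S(3) by (metis dim_eq_0 singleton_iff subsetI)
  let ?K = "S \<inter> sphere 0 1"
  have "compact ?K"
    by (rule closed_Int_compact[OF closed_subspace[OF S(1)] compact_sphere])
  moreover have "(1 / norm w) *\<^sub>R w \<in> ?K"
    using w S(1) by (simp add: subspace_scale)
  then have "?K \<noteq> {}" by blast
  moreover have "continuous_on ?K (\<lambda>x. x \<bullet> f x)"
    by (intro continuous_intros cf)
  ultimately obtain x where x: "x \<in> ?K" and mx: "\<And>y. y \<in> ?K \<Longrightarrow> y \<bullet> f y \<le> x \<bullet> f x"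
    using continuous_attains_sup by metis
  define l where "l = x \<bullet> f x"
  have xx: "x \<bullet> x = 1" using x by (simp add: dot_square_norm)
  have quad: "y \<bullet> f y \<le> l * (y \<bullet> y)" if "y \<in> S" for y
  proof (cases "y = 0")
    case False
    have "(1 / norm y) *\<^sub>R y \<in> ?K"
      using that False S(1) by (simp add: subspace_scale)
    from mx[OF this] have "(y \<bullet> f y) / (norm y * norm y) \<le> l"
      by (simp add: l_def linear_scale[OF f])
    then show ?thesis
      using False by (simp add: field_simps dot_square_norm power2_eq_square)
  qed (simp add: linear_0[OF f])
  have orth: "x \<bullet> f y = 0" if y: "y \<in> S" "x \<bullet> y = 0" for y
  proof (rule ccontr)
    assume ne: "x \<bullet> f y \<noteq> 0"
    define a where "a = x \<bullet> f y"
    define c where "c = \<bar>y \<bullet> f y - l * (y \<bullet> y)\<bar> + 1"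
    \<comment> \<open>This step size makes the linear gain twice the bound on the quadratic loss.\<close>
    define t where "t = a / c"
    have c: "c > 0" by (simp add: c_def)
    have "x + t *\<^sub>R y \<in> S"
      using x y S(1) by (simp add: subspace_add subspace_scale)
    note q = quad[OF this]
    have yx: "y \<bullet> x = 0" using y(2) by (simp add: inner_commute)
    have yfx: "y \<bullet> f x = a" unfolding a_def using sa[of y x] by (simp only: inner_commute)
    have "(x + t *\<^sub>R y) \<bullet> f (x + t *\<^sub>R y) = l + 2 * t * a + t\<^sup>2 * (y \<bullet> f y)"
      unfolding linear_add[OF f] linear_scale[OF f] inner_add_left inner_add_right
        inner_scaleR_left inner_scaleR_right yfx l_def[symmetric] a_def[symmetric]
      by (simp add: power2_eq_square algebra_simps)
    moreover have "(x + t *\<^sub>R y) \<bullet> (x + t *\<^sub>R y) = 1 + t\<^sup>2 * (y \<bullet> y)"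
      by (simp add: inner_add_left inner_add_right xx y(2) yx power2_eq_square)
    ultimately have "2 * t * a + t\<^sup>2 * (y \<bullet> f y - l * (y \<bullet> y)) \<le> 0"
      using q by (simp add: algebra_simps)
    moreover have "t\<^sup>2 * (y \<bullet> f y - l * (y \<bullet> y)) \<ge> t\<^sup>2 * (- c)"
      by (intro mult_left_mono) (auto simp: c_def)
    moreover have "2 * t * a + t\<^sup>2 * (- c) = a\<^sup>2 / c"
      using c by (simp add: t_def field_simps power2_eq_square)
    moreover have "a\<^sup>2 / c > 0" using c ne by (simp add: a_def)
    ultimately show False by linarith
  qed
  define y where "y = f x - l *\<^sub>R x"
  have yS: "y \<in> S" using x S by (auto simp: y_def intro!: subspace_diff subspace_scale)
  have xy: "x \<bullet> y = 0" by (simp add: y_def inner_diff_right xx l_def)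
  have "y \<bullet> y = x \<bullet> f y - l * (x \<bullet> y)"
    using sa[of x y] by (simp add: y_def inner_diff_left)
  also have "\<dots> = 0" using orth[OF yS xy] xy by simp
  finally have "f x = l *\<^sub>R x" by (simp add: y_def)
  then show thesis using x that by auto
qed

text \<open>
  Induction on the dimension: a self-adjoint map preserves the orthogonal complement of an
  eigenvector inside an invariant subspace.
\<close>

lemma self_adjoint_orthonormal_eigenvectors:
  fixes f :: "'a::euclidean_space \<Rightarrow> 'a"
  assumes f: "linear f" and sa: "\<And>x y. x \<bullet> f y = f x \<bullet> y"
    and S: "subspace S" "f ` S \<subseteq> S"
  shows "\<exists>B. finite B \<and> card B = dim S \<and> pairwise orthogonal B \<and>
              (\<forall>b\<in>B. b \<in> S \<and> norm b = 1 \<and> (\<exists>l. f b = l *\<^sub>R b))"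
  using S
proof (induction "dim S" arbitrary: S)
  case 0
  then show ?case by (intro exI[of _ "{}"]) auto
next
  case (Suc n S)
  then have "dim S \<noteq> 0" by linarith
  then obtain x l where x: "x \<in> S" "norm x = 1" "f x = l *\<^sub>R x"
    using self_adjoint_has_eigenvector[OF f sa Suc.prems] by metis
  define S' where "S' = {y \<in> S. \<forall>z\<in>span {x}. orthogonal z y}"
  have sub: "subspace S'"
    using Suc.prems(1) unfolding S'_def subspace_def
    by (auto simp: orthogonal_clauses)
  have "span {x} \<subseteq> S"
    using x(1) Suc.prems(1) by (simp add: span_minimal)
  then have "dim S' + dim (span {x}) = dim S"
    unfolding S'_def by (intro dim_subspace_orthogonal_to_vectors) (auto simp: Suc.prems)
  moreover have "dim (span {x}) = 1"
    using x(2) by (auto simp: dim_insert)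
  ultimately have n: "n = dim S'" using Suc.hyps(2) by simp
  have xorth: "x \<bullet> y = 0" if "y \<in> S'" for y
    using that span_base[of x "{x}"] by (auto simp: S'_def orthogonal_def)
  have "f y \<in> S'" if y: "y \<in> S'" for y
  proof -
    have "z \<bullet> f y = 0" if "z \<in> span {x}" for z
      using that xorth[OF y] sa[of x y] x(3) by (auto simp: span_singleton)
    then show ?thesis using y Suc.prems(2) by (auto simp: S'_def orthogonal_def)
  qed
  then obtain B where B: "finite B" "card B = dim S'" "pairwise orthogonal B"
      "\<And>b. b \<in> B \<Longrightarrow> b \<in> S' \<and> norm b = 1 \<and> (\<exists>l. f b = l *\<^sub>R b)"
    using Suc.hyps(1)[OF n sub] by blast
  have "x \<notin> B" using B(4) xorth[of x] x(2) by (auto simp: norm_eq_sqrt_inner)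
  then show ?case
    using B x xorth n Suc.hyps(2)
    by (intro exI[of _ "insert x B"])
       (auto simp: pairwise_insert orthogonal_def inner_commute S'_def)
qed

text \<open>
  Orthonormal bases indexed by the coordinates themselves, so that sums over a basis become sums
  over \<open>UNIV\<close> and \<open>frame_matrix\<close> is a square matrix.
\<close>

definition orthonormal_frame :: "('n::finite \<Rightarrow> real^'n) \<Rightarrow> bool" where
  "orthonormal_frame e \<longleftrightarrow> (\<forall>i j. e i \<bullet> e j = (if i = j then 1 else 0))"

lemma frame_inner: "orthonormal_frame e \<Longrightarrow> e i \<bullet> e j = (if i = j then 1 else 0)"
  by (simp add: orthonormal_frame_def)

theorem symmetric_matrix_eigenframe:
  fixes A :: "real^'n^'n"
  assumes sa: "\<And>x y. x \<bullet> (A *v y) = (A *v x) \<bullet> y"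
  obtains e l where "orthonormal_frame e" "\<And>i. A *v e i = l i *\<^sub>R e i"
proof -
  obtain B where B: "finite B" "card B = dim (UNIV :: (real^'n) set)"
      "pairwise orthogonal B" "\<And>b. b \<in> B \<Longrightarrow> norm b = 1 \<and> (\<exists>l. A *v b = l *\<^sub>R b)"
    using self_adjoint_orthonormal_eigenvectors[OF matrix_vector_mul_linear sa, of UNIV] by auto
  then have "card B = CARD('n)" by simp
  then obtain e where e: "bij_betw e (UNIV :: 'n set) B"
    using B(1) finite_same_card_bij[of "UNIV :: 'n set" B] by auto
  then have eB: "e i \<in> B" for i by (auto simp: bij_betw_def)
  have "\<exists>l. \<forall>i. A *v e i = l i *\<^sub>R e i"
    using B(4) eB by (intro choice) blast
  moreover have "orthonormal_frame e"
    unfolding orthonormal_frame_def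
  proof (intro allI)
    fix i j
    show "e i \<bullet> e j = (if i = j then 1 else 0)"
    proof (cases "i = j")
      case True then show ?thesis using B(4) eB by (simp add: dot_square_norm)
    next
      case False
      then have "e i \<noteq> e j" using e by (auto simp: bij_betw_def inj_on_def)
      then show ?thesis using B(3) eB False by (auto simp: pairwise_def orthogonal_def)
    qed
  qed
  ultimately show thesis using that by blast
qed

definition frame_matrix :: "('n::finite \<Rightarrow> real^'n) \<Rightarrow> real^'n^'n" where
  "frame_matrix e = (\<chi> i. e i)"

lemma frame_matrix_mult: "frame_matrix e *v x = (\<chi> i. e i \<bullet> x)"
  by (simp add: frame_matrix_def matrix_vector_mult_def inner_vec_def)

lemma orthogonal_frame_matrix:
  assumes "orthonormal_frame e" shows "orthogonal_matrix (frame_matrix e)"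
  using assms unfolding orthogonal_matrix_orthonormal_rows
  by (auto simp: frame_matrix_def row_def orthonormal_frame_def orthogonal_def norm_eq_1
        vec_lambda_eta)

lemma orthogonal_transformation_frame:
  assumes "orthonormal_frame e" shows "orthogonal_transformation (\<lambda>x. \<chi> i. e i \<bullet> x)"
proof -
  have "orthogonal_transformation ((*v) (frame_matrix e))"
    using orthogonal_frame_matrix[OF assms] by (simp add: orthogonal_transformation_matrix)
  moreover have "(*v) (frame_matrix e) = (\<lambda>x. \<chi> i. e i \<bullet> x)"
    by (rule ext) (rule frame_matrix_mult)
  ultimately show ?thesis by simp
qed

lemma frame_parseval:
  assumes "orthonormal_frame e" shows "(\<Sum>i\<in>UNIV. (e i \<bullet> x)\<^sup>2) = (norm x)\<^sup>2"
proof -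
  have "norm (\<chi> i. e i \<bullet> x) = norm x"
    using orthogonal_transformation_frame[OF assms] orthogonal_transformation_norm by blast
  then have "(\<chi> i. e i \<bullet> x) \<bullet> (\<chi> i. e i \<bullet> x) = (norm x)\<^sup>2"
    by (simp only: dot_square_norm)
  then show ?thesis by (simp add: inner_vec_def power2_eq_square)
qed

lemma
  fixes A :: "real^'n^'n"
  assumes e: "orthonormal_frame e" and A: "\<And>i. A *v e i = t i *\<^sub>R e i" and t: "\<And>i. t i \<noteq> 0"
  shows eigenframe_det: "det A = (\<Prod>i\<in>UNIV. t i)"
    and eigenframe_inverse_form: "w \<bullet> (matrix_inv A *v w) = (\<Sum>i\<in>UNIV. (e i \<bullet> w)\<^sup>2 / t i)"
proof -
  let ?Q = "frame_matrix e"
  let ?D = "(\<chi> i j. if i = j then t i else 0) :: real^'n^'n"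
  have Q: "orthogonal_matrix ?Q" by (rule orthogonal_frame_matrix[OF e])
  have tQ: "transpose ?Q *v y = (\<Sum>i\<in>UNIV. y $ i *\<^sub>R e i)" for y
    by (simp add: matrix_vector_mult_def frame_matrix_def transpose_def vec_eq_iff mult.commute)
  have QQ: "transpose ?Q *v (?Q *v x) = x" for x
    using Q by (metis matrix_vector_mul_assoc matrix_vector_mul_lid orthogonal_matrix_def)
  have exp: "x = (\<Sum>i\<in>UNIV. (e i \<bullet> x) *\<^sub>R e i)" for x
    using QQ[of x] unfolding tQ by (simp add: frame_matrix_mult)
  have Av: "A *v x = (\<Sum>i\<in>UNIV. ((e i \<bullet> x) * t i) *\<^sub>R e i)" for x
  proof -
    have "A *v x = A *v (\<Sum>i\<in>UNIV. (e i \<bullet> x) *\<^sub>R e i)" using exp[of x] by simp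
    also have "\<dots> = (\<Sum>i\<in>UNIV. ((e i \<bullet> x) * t i) *\<^sub>R e i)"
      by (simp add: vec.sum linear_sum matrix_vector_mult_scaleR A)
    finally show ?thesis .
  qed
  have Dv: "?D *v y = (\<chi> i. t i * y $ i)" for y
    by (simp add: matrix_vector_mult_def if_distrib[of "\<lambda>z. z * u" for u] cong: if_cong)
  \<comment> \<open>Conjugation by the frame turns \<open>A\<close> into a diagonal matrix, whose determinant is known.\<close>
  have QA: "?Q ** A = ?D ** ?Q"
  proof -
    have "?Q *v (A *v x) = ?D *v (?Q *v x)" for x
    proof -
      have "e j \<bullet> (A *v x) = t j * (e j \<bullet> x)" for j
        using e by (simp add: Av inner_sum_right frame_inner if_distrib cong: if_cong)
      then show ?thesis
        unfolding Dv frame_matrix_mult by (simp add: vec_eq_iff)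
    qed
    then show ?thesis
      by (simp add: matrix_eq matrix_vector_mul_assoc[symmetric])
  qed
  have "det ?Q * det A = det ?D * det ?Q" using arg_cong[OF QA, of det] by (simp only: det_mul)
  moreover have "det ?Q \<noteq> 0" using det_orthogonal_matrix[OF Q] by auto
  moreover have "det ?D = (\<Prod>i\<in>UNIV. t i)" by (subst det_diagonal) auto
  ultimately show d: "det A = (\<Prod>i\<in>UNIV. t i)" by simp
  then have "invertible A" using t by (simp add: invertible_det_nz)
  define y where "y = (\<Sum>i\<in>UNIV. ((e i \<bullet> w) / t i) *\<^sub>R e i)"
  have ey: "e j \<bullet> y = (e j \<bullet> w) / t j" for j
    using e by (simp add: y_def inner_sum_right frame_inner if_distrib cong: if_cong)
  have "A *v y = w"
    using t exp[of w] by (simp add: Av ey)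
  moreover have "matrix_inv A ** A = mat 1"
    using \<open>invertible A\<close> unfolding matrix_inv_def invertible_def
    by (rule someI2_ex) blast
  ultimately have "matrix_inv A *v w = y"
    by (metis matrix_vector_mul_assoc matrix_vector_mul_lid)
  then show "w \<bullet> (matrix_inv A *v w) = (\<Sum>i\<in>UNIV. (e i \<bullet> w)\<^sup>2 / t i)"
    by (simp add: y_def inner_sum_right power2_eq_square inner_commute)
qed

section \<open>The density of the internal energy variable\<close>

text \<open>
  Integrability on the half-line follows by comparison with \<open>1 / (1 + x\<^sup>2)\<close>: a single term
  \<open>y ^ k / k!\<close> of the exponential series at \<open>y = x powr p\<close> beats \<open>x\<^sup>2\<close> as soon as \<open>p k > 2\<close>.
\<close>

lemma exp_powr_bound:
  assumes "p > (0::real)"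
  obtains C where "C > 0" "\<And>x. x \<ge> 0 \<Longrightarrow> exp (- (x powr p)) \<le> C * inverse (1 + x\<^sup>2)"
proof -
  obtain k :: nat where k: "2 / p < real k" using reals_Archimedean2 by blast
  have e: "exp (- y) * y ^ k \<le> fact k" if "y \<ge> 0" for y :: real
  proof -
    have "y ^ k / fact k \<le> exp y"
    proof -
      have "(\<Sum>n\<in>{k}. y ^ n / fact n) \<le> (\<Sum>n. y ^ n / fact n)"
        using summable_exp[of y] that
        by (intro sum_le_suminf) (auto simp: divide_inverse mult.commute)
      then show ?thesis by (simp add: exp_def divide_inverse mult.commute scaleR_conv_of_real)
    qed
    then show ?thesis by (simp add: exp_minus field_simps)
  qed
  have "exp (- (x powr p)) * (1 + x\<^sup>2) \<le> 2 * fact k" if x: "x \<ge> 0" for x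
  proof (cases "x \<le> 1")
    case True
    have "exp (- (x powr p)) * (1 + x\<^sup>2) \<le> 1 * 2"
      using x True by (intro mult_mono) (auto simp: power_le_one)
    also have "\<dots> \<le> 2 * fact k" using fact_ge_1[of k, where 'a=real] by simp
    finally show ?thesis .
  next
    case False
    have "x\<^sup>2 = x powr 2" using False by (simp add: powr_numeral)
    also have "\<dots> \<le> x powr (p * k)"
      using False k assms by (intro powr_mono) (auto simp: field_simps)
    also have "\<dots> = (x powr p) ^ k"
      using False by (simp add: powr_powr[symmetric] powr_realpow)
    finally have "x\<^sup>2 \<le> (x powr p) ^ k" .
    then have "exp (- (x powr p)) * x\<^sup>2 \<le> fact k"
      using e[of "x powr p"] by (smt (verit) exp_gt_zero mult_left_mono powr_ge_zero)
    moreover have "1 \<le> x\<^sup>2" using False by simp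
    then have "exp (- (x powr p)) * 1 \<le> exp (- (x powr p)) * x\<^sup>2"
      by (intro mult_left_mono) auto
    moreover have "exp (- (x powr p)) * (1 + x\<^sup>2)
        = exp (- (x powr p)) * 1 + exp (- (x powr p)) * x\<^sup>2"
      by (rule distrib_left)
    ultimately show ?thesis by linarith
  qed
  then show thesis
    by (intro that[of "2 * fact k"]) (auto simp: field_simps add_pos_nonneg)
qed

lemma integrable_exp_powr:
  assumes "p > (0::real)"
  shows "integrable lborel (\<lambda>x. indicator {0..} x * exp (- (x powr p)))"
proof -
  obtain C where C: "C > 0" "\<And>x. x \<ge> 0 \<Longrightarrow> exp (- (x powr p)) \<le> C * inverse (1 + x\<^sup>2)"
    using exp_powr_bound[OF assms] by blast
  show ?thesis
  proof (rule Bochner_Integration.integrable_bound)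
    show "integrable lborel (\<lambda>x::real. C * inverse (1 + x\<^sup>2))"
      using integrable_inverse_1_plus_square by (simp add: set_integrable_def einterval_def)
    show "AE x in lborel. norm (indicator {0..} x * exp (- (x powr p))) \<le> norm (C * inverse (1 + x\<^sup>2))"
      using C by (auto simp: indicator_def intro!: AE_I2)
  qed measurable
qed

text \<open>
  Substitution \<open>x = T powr (1 / p) * y\<close>. It turns the internal temperature into the prefactor
  \<open>T powr (\<delta> / 2)\<close> of the Gaussian.
\<close>

lemma exp_powr_integral_scaled:
  assumes p: "p > (0::real)" and T: "T > 0"
  shows "integrable lborel (\<lambda>x. indicator {0..} x * exp (- (x powr p / T)))" (is ?I)
    and "(LINT x|lborel. indicator {0..} x * exp (- (x powr p / T)))
      = T powr (1 / p) * (LINT x|lborel. indicator {0..} x * exp (- (x powr p)))" (is ?E)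
proof -
  define c where "c = T powr (1 / p)"
  have c: "c > 0" using T by (simp add: c_def)
  let ?f = "\<lambda>x. indicator {0..} x * exp (- (x powr p / T))"
  have fc: "?f (0 + c * x) = indicator {0..} x * exp (- (x powr p))" for x
  proof -
    have "(c * x) powr p / T = x powr p" if "x \<ge> 0"
      using that c T p by (simp add: powr_mult) (simp add: c_def powr_powr)
    then show ?thesis using c by (auto simp: indicator_def zero_le_mult_iff)
  qed
  show ?I
    using integrable_exp_powr[OF p] lborel_integrable_real_affine_iff[of c ?f 0] c
    unfolding fc by simp
  show ?E
    using lborel_integral_real_affine[of c ?f 0] c unfolding fc by (simp add: c_def)
qed

text \<open>
  Integration by parts: the derivative of \<open>x exp (- x powr p)\<close> is
  \<open>exp (- x powr p) - p x powr p exp (- x powr p)\<close>, and the primitive vanishes at \<open>0\<close> and at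
  infinity. For \<open>p = 2 / \<delta>\<close> this is the equipartition of energy, \<open>\<delta> / 2\<close> per unit temperature.
\<close>

lemma exp_powr_moment:
  assumes p: "p > (0::real)"
  shows "integrable lborel (\<lambda>x. indicator {0..} x * (x powr p * exp (- (x powr p))))" (is ?I)
    and "(LINT x|lborel. indicator {0..} x * exp (- (x powr p)))
      = p * (LINT x|lborel. indicator {0..} x * (x powr p * exp (- (x powr p))))"  (is ?E)
proof -
  have y: "y * exp (- y) \<le> 2 * exp (- (y / 2))" for y :: real
  proof -
    have "y / 2 \<le> exp (y / 2)" using exp_ge_add_one_self[of "y / 2"] by linarith
    then have "(y / 2) * exp (- y) \<le> exp (y / 2) * exp (- y)" by (intro mult_right_mono) auto
    also have "\<dots> = exp (- (y / 2))" by (simp add: mult_exp_exp)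
    finally show ?thesis by simp
  qed
  show I: ?I
  proof (rule Bochner_Integration.integrable_bound)
    show "integrable lborel (\<lambda>x::real. 2 * (indicator {0..} x * exp (- (x powr p / 2))))"
      using exp_powr_integral_scaled(1)[OF p, of 2] by simp
    show "AE x in lborel. norm (indicator {0..} x * (x powr p * exp (- (x powr p))))
        \<le> norm (2 * (indicator {0..} x * exp (- (x powr p / 2))))"
      using y by (auto simp: indicator_def intro!: AE_I2)
  qed measurable
  let ?g = "\<lambda>x. exp (- (x powr p)) - p * (x powr p * exp (- (x powr p)))"
  let ?F = "\<lambda>x::real. x * exp (- (x powr p))"
  have ig: "integrable lborel (\<lambda>x. indicator {0..} x * ?g x)"
    using I integrable_exp_powr[OF p] by (simp add: algebra_simps)
  have ae: "AE x in lborel. indicator {0..} x * ?g x = indicator {0<..} x * ?g x"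
    using AE_lborel_singleton[of "0::real"] by eventually_elim (auto simp: indicator_def)
  have "(LBINT x=0..\<infinity>. ?g x) = 0 - 0"
  proof (rule interval_integral_FTC_integrable)
    fix x :: real assume "0 < ereal x"
    then have x: "x > 0" by simp
    show "(?F has_vector_derivative ?g x) (at x)"
      unfolding has_real_derivative_iff_has_vector_derivative[symmetric]
      using x by (auto intro!: derivative_eq_intros simp: powr_diff field_simps)
    show "isCont ?g x" using x by (intro continuous_intros) auto
  next
    have "integrable lborel (\<lambda>x. indicator {0<..} x * ?g x)"
      using ig by (rule integrable_cong_AE_imp) (use ae in auto)
    then show "set_integrable lborel (einterval 0 \<infinity>) ?g"
      by (simp add: set_integrable_def einterval_def greaterThan_def)
  next
    have "((\<lambda>x. ?F x) \<longlongrightarrow> 0) (at_right 0)" using p by real_asymp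
    then show "((?F \<circ> real_of_ereal) \<longlongrightarrow> 0) (at_right 0)"
      by (simp add: zero_ereal_def ereal_tendsto_simps)
    have "(?F \<longlongrightarrow> 0) at_top" using p by real_asymp
    then show "((?F \<circ> real_of_ereal) \<longlongrightarrow> 0) (at_left \<infinity>)"
      by (simp add: ereal_tendsto_simps)
  qed simp
  then have "(LINT x|lborel. indicator {0<..} x * ?g x) = 0"
    by (simp add: interval_lebesgue_integral_def set_lebesgue_integral_def einterval_def greaterThan_def)
  then have "(LINT x|lborel. indicator {0..} x * ?g x) = 0"
    using integral_cong_AE[OF _ _ ae] by simp
  then show ?E
    using I integrable_exp_powr[OF p] by (simp add: algebra_simps)
qed

lemma exp_powr_integral_pos:
  assumes p: "p > (0::real)"
  shows "0 < (LINT x|lborel. indicator {0..} x * exp (- (x powr p)))"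
proof -
  let ?h = "\<lambda>x. indicator {0..} x * exp (- (x powr p))"
  have "(LINT x|lborel. ?h x) \<noteq> 0"
  proof
    assume "(LINT x|lborel. ?h x) = 0"
    then have "AE x in lborel. ?h x = 0"
      using integral_nonneg_eq_0_iff_AE[OF integrable_exp_powr[OF p]] by simp
    then have "AE x in lborel. x \<notin> {0..1::real}"
      by eventually_elim (auto simp: indicator_def)
    then have "emeasure lborel {0..1::real} = 0"
      by (subst (asm) AE_iff_measurable[of "{0..1}"]) auto
    then show False by simp
  qed
  moreover have "0 \<le> (LINT x|lborel. ?h x)" by simp
  ultimately show ?thesis by linarith
qed

definition internal_density :: "real \<Rightarrow> real \<Rightarrow> real \<Rightarrow> real" where
  "internal_density d T I = Lambda d / T powr (d / 2) * exp (- (I powr (2 / d) / T))"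

lemma Lambda_eq: "Lambda d = inverse (LINT x|lborel. indicator {0..} x * exp (- (x powr (2 / d))))"
proof -
  have "(\<lambda>x. indicator {0..} x * exp (- (x powr (2 / d)))) \<in> borel_measurable lborel" by measurable
  then show ?thesis
    unfolding Lambda_def by (subst integral_restrict_space) (auto simp: integral_completion)
qed

lemma Lambda_pos: "d > 0 \<Longrightarrow> Lambda d > 0"
  unfolding Lambda_eq using exp_powr_integral_pos[of "2 / d"] by simp

lemma internal_density_moments:
  assumes d: "d > 0" and T: "T > 0"
  shows "has_bochner_integral lborel (\<lambda>x. indicator {0..} x * internal_density d T x) 1"
    and "has_bochner_integral lborel
          (\<lambda>x. indicator {0..} x * (x powr (2 / d) * internal_density d T x)) (d / 2 * T)"
proof -
  have p: "2 / d > 0" using d by simp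
  define J where "J = (LINT x|lborel. indicator {0..} x * exp (- (x powr (2 / d))))"
  have J: "J > 0" unfolding J_def by (rule exp_powr_integral_pos[OF p])
  have L: "Lambda d = inverse J" by (simp add: Lambda_eq J_def)
  have "has_bochner_integral lborel (\<lambda>x. indicator {0..} x * exp (- (x powr (2 / d) / T)))
      (T powr (d / 2) * J)"
    using exp_powr_integral_scaled[OF p T] by (simp add: has_bochner_integral_iff J_def)
  from has_bochner_integral_mult_right[OF this, of "Lambda d / T powr (d / 2)"]
  show "has_bochner_integral lborel (\<lambda>x. indicator {0..} x * internal_density d T x) 1"
    using J T by (simp add: internal_density_def L mult.left_commute)
  define c where "c = T powr (d / 2)"
  have c: "c > 0" using T by (simp add: c_def)
  let ?f = "\<lambda>x. indicator {0..} x * (x powr (2 / d) * exp (- (x powr (2 / d) / T)))"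
  have fc: "?f (0 + c * x) = T * (indicator {0..} x * (x powr (2 / d) * exp (- (x powr (2 / d)))))" for x
  proof -
    have "(c * x) powr (2 / d) = T * x powr (2 / d)" if "x \<ge> 0"
      using that c T d by (simp add: powr_mult) (simp add: c_def powr_powr)
    then show ?thesis using c T by (auto simp: indicator_def zero_le_mult_iff)
  qed
  have "integrable lborel ?f"
    using exp_powr_moment(1)[OF p] lborel_integrable_real_affine_iff[of c ?f 0] c
    unfolding fc by simp
  moreover have "(LINT x|lborel. ?f x) = c * (T * (J * (d / 2)))"
    using lborel_integral_real_affine[of c ?f 0] c exp_powr_moment(2)[OF p] d unfolding fc
    by (simp add: J_def)
  ultimately have "has_bochner_integral lborel ?f (c * (T * (J * (d / 2))))"
    by (simp add: has_bochner_integral_iff)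
  from has_bochner_integral_mult_right[OF this, of "Lambda d / T powr (d / 2)"]
  show "has_bochner_integral lborel
          (\<lambda>x. indicator {0..} x * (x powr (2 / d) * internal_density d T x)) (d / 2 * T)"
    using J T by (simp add: internal_density_def L mult.left_commute c_def[symmetric])
      (use c in \<open>simp add: field_simps\<close>)
qed

section \<open>Gaussian integrals in an orthonormal frame\<close>

text \<open>
  Lebesgue measure is determined by the measure of boxes, and an orthogonal transformation
  preserves the measure of the image of a box.
\<close>

lemma distr_lborel_orthogonal:
  fixes T :: "real^'n::{finite,wellorder} \<Rightarrow> real^'n::_"
  assumes T: "orthogonal_transformation T"
  shows "distr lborel borel T = lborel"
proof (rule lborel_eqI[symmetric])
  have lin: "linear T" using T by (rule orthogonal_transformation_linear)
  then have [measurable]: "T \<in> borel_measurable borel"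
    by (intro borel_measurable_continuous_onI linear_continuous_on)
       (simp add: linear_conv_bounded_linear)
  fix l u :: "real^'n::_"
  assume lu: "\<And>b. b \<in> Basis \<Longrightarrow> l \<bullet> b \<le> u \<bullet> b"
  have inv: "orthogonal_transformation (inv T)"
    using T by (rule orthogonal_transformation_inv)
  have vim: "T -` box l u = inv T ` box l u"
    using bij_vimage_eq_inv_image[OF orthogonal_transformation_bij[OF T]] .
  have bl: "box l u \<in> lmeasurable" by simp
  have im: "inv T ` box l u \<in> lmeasurable"
    by (rule measurable_orthogonal_image[OF inv bl])
  have "emeasure (distr lborel borel T) (box l u) = emeasure lborel (T -` box l u)"
    by (simp add: emeasure_distr)
  also have "\<dots> = emeasure lebesgue (inv T ` box l u)"
    unfolding vim[symmetric] using measurable_sets[of T borel borel "box l u"] by simp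
  also have "\<dots> = ennreal (measure lebesgue (inv T ` box l u))"
    using im by (simp add: emeasure_eq_measure2 fmeasurableD2)
  also have "\<dots> = ennreal (measure lebesgue (box l u))"
    by (simp add: measure_orthogonal_image[OF inv bl])
  also have "\<dots> = ennreal (\<Prod>b\<in>Basis. (u - l) \<bullet> b)"
    using lu by (simp add: measure_lborel_box_eq)
  finally show "emeasure (distr lborel borel T) (box l u) = (\<Prod>b\<in>Basis. (u - l) \<bullet> b)" .
qed simp

lemma distr_lborel_frame:
  fixes e :: "'n::{finite,wellorder} \<Rightarrow> real^'n::_"
  assumes "orthonormal_frame e"
  shows "distr lborel borel (\<lambda>v. \<chi> i. e i \<bullet> (v - u)) = lborel"
proof -
  let ?T = "\<lambda>x. (\<chi> i. e i \<bullet> x)"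
  have T: "orthogonal_transformation ?T" by (rule orthogonal_transformation_frame[OF assms])
  then have [measurable]: "?T \<in> borel_measurable borel"
    by (intro borel_measurable_continuous_onI linear_continuous_on)
       (simp add: linear_conv_bounded_linear[symmetric] orthogonal_transformation_linear)
  have "distr lborel borel (?T \<circ> (+) (- u)) = distr (distr lborel borel ((+) (- u))) borel ?T"
    by (subst distr_distr) auto
  also have "distr lborel borel ((+) (- u)) = lborel" by (rule lborel_distr_plus)
  finally show ?thesis by (simp add: distr_lborel_orthogonal[OF T] comp_def)
qed

text \<open>
  Fubini over all coordinates at once, through the presentation of \<open>lborel\<close> as a product measure
  over \<open>Basis\<close>.
\<close>

lemma has_bochner_integral_lborel_prod_vec:
  fixes h :: "'n::finite \<Rightarrow> real \<Rightarrow> real"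
  assumes h: "\<And>i. has_bochner_integral lborel (h i) (c i)"
  shows "has_bochner_integral lborel (\<lambda>x::real^'n. \<Prod>i\<in>UNIV. h i (x $ i)) (\<Prod>i\<in>UNIV. c i)"
proof -
  interpret product_sigma_finite "\<lambda>_::real^'n. lborel :: real measure" by standard
  let ?a = "\<lambda>i::'n. axis i (1::real)"
  have bij: "bij_betw ?a UNIV Basis"
    by (auto simp: bij_betw_def inj_on_def axis_eq_axis Basis_vec_def)
  define k where "k b = h (inv ?a b)" for b
  have ka: "k (?a i) = h i" for i
    unfolding k_def by (subst inv_f_f) (auto simp: inj_on_def axis_eq_axis)
  have int: "integrable lborel (h i)" and val: "integral\<^sup>L lborel (h i) = c i" for i
    using h[of i] by (auto simp: has_bochner_integral_iff)
  have intk: "integrable lborel (k b)" if "b \<in> Basis" for b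
    using int that by (auto simp: k_def)
  have [measurable]: "h i \<in> borel_measurable borel" for i
    using int[of i] by (auto dest: borel_measurable_integrable)
  have pr: "(\<Prod>i\<in>UNIV. h i (x $ i)) = (\<Prod>b\<in>Basis. k b (x \<bullet> b))" for x :: "real^'n"
    using prod.reindex_bij_betw[OF bij, of "\<lambda>b. k b (x \<bullet> b)"]
    by (simp add: ka inner_axis)
  have dm: "(\<lambda>f. \<Sum>b\<in>Basis. f b *\<^sub>R b) \<in> measurable (\<Pi>\<^sub>M b\<in>Basis. lborel) (borel :: (real^'n) measure)"
    by measurable
  have sb: "(\<Sum>b'\<in>Basis. f b' *\<^sub>R b') \<bullet> b = f b" if "b \<in> Basis" for b :: "real^'n" and f
    using that by simp
  have fm: "(\<lambda>x::real^'n. \<Prod>i\<in>UNIV. h i (x $ i)) \<in> borel_measurable borel" by measurable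
  have "has_bochner_integral (\<Pi>\<^sub>M b\<in>(Basis::(real^'n) set). lborel) (\<lambda>f. \<Prod>b\<in>Basis. k b (f b))
      (\<Prod>b\<in>Basis. integral\<^sup>L lborel (k b))"
    using product_integrable_prod[of Basis k] product_integral_prod[of Basis k] intk
    by (simp add: has_bochner_integral_iff)
  also have "(\<Prod>b\<in>Basis. integral\<^sup>L lborel (k b)) = (\<Prod>i\<in>UNIV. c i)"
    using prod.reindex_bij_betw[OF bij, of "\<lambda>b. integral\<^sup>L lborel (k b)"] by (simp add: ka val)
  finally have "has_bochner_integral (\<Pi>\<^sub>M b\<in>(Basis::(real^'n) set). lborel)
      (\<lambda>f. \<Prod>i\<in>UNIV. h i ((\<Sum>b\<in>Basis. f b *\<^sub>R b) $ i)) (\<Prod>i\<in>UNIV. c i)"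
    unfolding pr by (simp add: sb cong: prod.cong)
  then show ?thesis
    unfolding has_bochner_integral_iff
    using integrable_distr_eq[OF dm fm] integral_distr[OF dm fm] lborel_eq[where 'a="real^'n"]
    by simp
qed

lemma has_bochner_integral_lborel_frame_prod:
  fixes e :: "'n::{finite,wellorder} \<Rightarrow> real^'n::_" and h :: "'n \<Rightarrow> real \<Rightarrow> real"
  assumes e: "orthonormal_frame e" and h: "\<And>i. has_bochner_integral lborel (h i) (c i)"
  shows "has_bochner_integral lborel (\<lambda>v. \<Prod>i\<in>UNIV. h i (e i \<bullet> (v - u))) (\<Prod>i\<in>UNIV. c i)"
proof -
  let ?g = "\<lambda>v. \<chi> i. e i \<bullet> (v - u)"
  let ?F = "\<lambda>x::real^'n::_. \<Prod>i\<in>UNIV. h i (x $ i)"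
  have [measurable]: "h i \<in> borel_measurable borel" for i
    using h[of i] by (auto simp: has_bochner_integral_iff dest: borel_measurable_integrable)
  have g: "?g \<in> measurable lborel borel"
    unfolding measurable_lborel2 by (intro borel_measurable_continuous_onI continuous_intros)
  have F: "?F \<in> borel_measurable borel"
    using has_bochner_integral_lborel_prod_vec[OF h]
    by (auto simp: has_bochner_integral_iff dest: borel_measurable_integrable)
  have "has_bochner_integral (distr lborel borel ?g) ?F (\<Prod>i\<in>UNIV. c i)"
    unfolding distr_lborel_frame[OF e] by (rule has_bochner_integral_lborel_prod_vec[OF h])
  then show ?thesis
    unfolding has_bochner_integral_iff using integrable_distr_eq[OF g F] integral_distr[OF g F]
    by simp
qed

text \<open>
  The normal density with mean \<open>u\<close> whose covariance matrix has the eigenvectors \<open>e i\<close> and the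
  eigenvalues \<open>t i\<close>.
\<close>

definition frame_normal :: "('n::finite \<Rightarrow> real^'n) \<Rightarrow> ('n \<Rightarrow> real) \<Rightarrow> real^'n \<Rightarrow> real^'n \<Rightarrow> real" where
  "frame_normal e t u v = (\<Prod>i\<in>UNIV. normal_density 0 (sqrt (t i)) (e i \<bullet> (v - u)))"

lemma has_bochner_integral_normal_density:
  assumes "t > 0"
  shows "has_bochner_integral lborel (normal_density 0 (sqrt t)) 1"
    and "has_bochner_integral lborel (\<lambda>x. x\<^sup>2 * normal_density 0 (sqrt t) x) t"
proof -
  show "has_bochner_integral lborel (normal_density 0 (sqrt t)) 1"
    using assms by (simp add: has_bochner_integral_iff)
  have "has_bochner_integral lborel (\<lambda>x. normal_density 0 (sqrt t) x * x\<^sup>2) t"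
    using normal_moment_even[of "sqrt t" 0 1] assms by (simp add: fact_2)
  then show "has_bochner_integral lborel (\<lambda>x. x\<^sup>2 * normal_density 0 (sqrt t) x) t"
    by (simp only: mult.commute)
qed

lemma frame_normal_moments:
  fixes e :: "'n::{finite,wellorder} \<Rightarrow> real^'n::_"
  assumes e: "orthonormal_frame e" and t: "\<And>i. t i > 0"
  shows "has_bochner_integral lborel (frame_normal e t u) 1"
    and "has_bochner_integral lborel (\<lambda>v. (e j \<bullet> (v - u))\<^sup>2 * frame_normal e t u v) (t j)"
proof -
  show "has_bochner_integral lborel (frame_normal e t u) 1"
    using has_bochner_integral_lborel_frame_prod[OF e, where c="\<lambda>_. 1",
      OF has_bochner_integral_normal_density(1)[OF t]]
    by (simp add: frame_normal_def[abs_def])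
  \<comment> \<open>The quadratic weight is put on the \<open>j\<close>-th factor of the product only.\<close>
  define h where "h i x = (if i = j then x\<^sup>2 else 1) * normal_density 0 (sqrt (t i)) x" for i and x :: real
  have "has_bochner_integral lborel (h i) (if i = j then t j else 1)" for i
    using has_bochner_integral_normal_density[OF t[of i]]
    by (cases "i = j") (simp_all add: h_def[abs_def])
  then have "has_bochner_integral lborel (\<lambda>v. \<Prod>i\<in>UNIV. h i (e i \<bullet> (v - u)))
      (\<Prod>i\<in>UNIV. if i = j then t j else 1)"
    by (rule has_bochner_integral_lborel_frame_prod[OF e])
  then
  show "has_bochner_integral lborel (\<lambda>v. (e j \<bullet> (v - u))\<^sup>2 * frame_normal e t u v) (t j)"
    by (simp add: h_def frame_normal_def prod.distrib)
qed

section \<open>Gaussians on phase space and their moments\<close>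

lemma phase_sets: "UNIV \<times> {0..} \<in> sets (borel :: ((real^3) \<times> real) measure)"
  by (intro borel_closed closed_Times) auto

lemma has_bochner_integral_phase_iff:
  fixes F :: "(real^3) \<times> real \<Rightarrow> real"
  assumes [measurable]: "F \<in> borel_measurable borel"
  shows "has_bochner_integral phase F c \<longleftrightarrow>
         has_bochner_integral lborel (\<lambda>z. indicator (UNIV \<times> {0..}) z * F z) c"
proof -
  have [measurable]: "(\<lambda>z. indicator (UNIV \<times> {0..}) z * F z) \<in> borel_measurable borel"
    using phase_sets by measurable
  show ?thesis
    unfolding has_bochner_integral_iff phase_def
    using phase_sets
    by (subst integrable_restrict_space, simp) (subst integral_restrict_space, simp,
        simp add: integrable_completion integral_completion)
qed

lemma has_bochner_integral_phase_product:
  fixes a :: "real^3 \<Rightarrow> real" and b :: "real \<Rightarrow> real"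
  assumes a: "has_bochner_integral lborel a x"
    and b: "has_bochner_integral lborel (\<lambda>I. indicator {0..} I * b I) y"
    and [measurable]: "b \<in> borel_measurable borel"
  shows "has_bochner_integral phase (\<lambda>(v, I). a v * b I) (x * y)"
proof -
  have [measurable]: "a \<in> borel_measurable borel"
    using a by (auto simp: has_bochner_integral_iff dest: borel_measurable_integrable)
  let ?b = "\<lambda>I. indicator {0..} I * b I"
  have "(\<lambda>z. a (fst z)) \<in> borel_measurable (lborel \<Otimes>\<^sub>M (lborel :: real measure))"
    by (rule measurable_compose[OF measurable_fst]) simp
  moreover have "(\<lambda>z. b (snd z)) \<in> borel_measurable ((lborel :: (real^3) measure) \<Otimes>\<^sub>M lborel)"
    by (rule measurable_compose[OF measurable_snd]) simp
  ultimately have "(\<lambda>z. a (fst z) * b (snd z)) \<in> borel_measurable (lborel \<Otimes>\<^sub>M lborel)"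
    by (rule borel_measurable_times)
  then have meas: "(\<lambda>(v, I). a v * b I) \<in> borel_measurable (borel :: ((real^3) \<times> real) measure)"
    by (simp add: lborel_prod case_prod_beta')
  have ia: "integrable lborel a" and ib: "integrable lborel ?b"
    using a b by (auto simp: has_bochner_integral_iff)
  have *: "integrable (lborel \<Otimes>\<^sub>M lborel) (\<lambda>(v, I). a v * ?b I)"
    by (rule lborel_pair.Fubini_integrable) (use ia ib in \<open>auto simp: norm_mult abs_mult\<close>)
  have "(LINT z|(lborel \<Otimes>\<^sub>M lborel). (\<lambda>(v, I). a v * ?b I) z) = (LINT v|lborel. LINT I|lborel. a v * ?b I)"
    using lborel_pair.integral_fst'[OF *] by simp
  also have "\<dots> = x * y" using a b by (simp add: has_bochner_integral_iff)
  finally have "has_bochner_integral lborel (\<lambda>(v, I). a v * ?b I) (x * y)"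
    using * by (simp add: has_bochner_integral_iff lborel_prod)
  then show ?thesis
    unfolding has_bochner_integral_phase_iff[OF meas]
    by (rule has_bochner_integral_cong[THEN iffD1, rotated -1]) (auto simp: indicator_def)
qed

text \<open>
  The moments of \<open>g\<close> that the logarithm of a Gaussian with frame \<open>e\<close> and mean \<open>u\<close> can see: the
  mass \<open>r\<close>, the directional temperatures \<open>l i\<close> about \<open>u\<close> and the internal temperature \<open>S\<close>.
\<close>

definition has_moments ::
  "real \<Rightarrow> (3 \<Rightarrow> real^3) \<Rightarrow> real^3 \<Rightarrow> real \<Rightarrow> (3 \<Rightarrow> real) \<Rightarrow> real \<Rightarrow> ((real^3) \<times> real \<Rightarrow> real) \<Rightarrow> bool" where
  "has_moments d e u r l S g \<longleftrightarrow>
     has_bochner_integral phase g r \<and>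
     (\<forall>j. has_bochner_integral phase (\<lambda>z. (e j \<bullet> (fst z - u))\<^sup>2 * g z) (r * l j)) \<and>
     has_bochner_integral phase (\<lambda>z. snd z powr (2 / d) * g z) (r * (d / 2 * S))"

definition frame_maxwellian ::
  "real \<Rightarrow> real \<Rightarrow> (3 \<Rightarrow> real^3) \<Rightarrow> (3 \<Rightarrow> real) \<Rightarrow> real^3 \<Rightarrow> real \<Rightarrow> (real^3) \<times> real \<Rightarrow> real" where
  "frame_maxwellian r d e t u T = (\<lambda>z. r * (frame_normal e t u (fst z) * internal_density d T (snd z)))"

lemma frame_normal_pos:
  assumes "\<And>i. t i > 0" shows "frame_normal e t u v > 0"
  unfolding frame_normal_def using assms by (intro prod_pos) (simp add: normal_density_pos)

lemma internal_density_pos: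
  assumes "d > 0" "T > 0" shows "internal_density d T I > 0"
  unfolding internal_density_def using assms Lambda_pos[of d] by simp

lemma frame_maxwellian_pos:
  assumes "r > 0" "d > 0" "\<And>i. t i > 0" "T > 0"
  shows "frame_maxwellian r d e t u T z > 0"
  unfolding frame_maxwellian_def using assms
  by (intro mult_pos_pos frame_normal_pos internal_density_pos)

lemma frame_maxwellian_has_moments:
  assumes "orthonormal_frame e" "d > 0" "\<And>i. t i > 0" "T > 0"
  shows "has_moments d e u r t T (frame_maxwellian r d e t u T)"
proof -
  note N = frame_normal_moments[where t=t and u=u, OF assms(1,3)]
  note I = internal_density_moments[OF assms(2,4)]
  have m [measurable]: "internal_density d T \<in> borel_measurable borel"
    "(\<lambda>I. I powr (2 / d) * internal_density d T I) \<in> borel_measurable borel"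
    unfolding internal_density_def[abs_def] by measurable
  have P: "has_bochner_integral phase (\<lambda>z. r * (a (fst z) * b (snd z))) (r * (x * y))"
    if "has_bochner_integral lborel a x" "has_bochner_integral lborel (\<lambda>I. indicator {0..} I * b I) y"
      "b \<in> borel_measurable borel" for a b x y
    using has_bochner_integral_mult_right[OF has_bochner_integral_phase_product[OF that], of r]
    by (simp add: case_prod_beta')
  show ?thesis
    unfolding has_moments_def frame_maxwellian_def
    using P[OF N(1) I(1) m(1)] P[OF N(2) I(1) m(1)] P[OF N(1) I(2) m(2)]
    by (auto simp: mult_ac)
qed

lemma ln_frame_maxwellian:
  assumes r: "r > 0" and d: "d > 0" and t: "\<And>i. t i > 0" and T: "T > 0"
  shows "ln (frame_maxwellian r d e t u T z)
    = ln (r * Lambda d) - 3 / 2 * ln (2 * pi) - 1 / 2 * (\<Sum>i\<in>UNIV. ln (t i)) - d / 2 * ln T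
      - 1 / 2 * (\<Sum>i\<in>UNIV. (e i \<bullet> (fst z - u))\<^sup>2 / t i) - snd z powr (2 / d) / T"
proof -
  have nd: "ln (normal_density 0 (sqrt (t i)) x) = - 1 / 2 * ln (2 * pi) - 1 / 2 * ln (t i) - 1 / 2 * (x\<^sup>2 / t i)"
    for i x using t[of i]
    by (simp add: normal_density_def ln_mult ln_div ln_sqrt algebra_simps)
  have pos: "normal_density 0 (sqrt (t i)) x > 0" for i x
    using t[of i] by (simp add: normal_density_pos)
  have "ln (frame_normal e t u v) =
      (\<Sum>i\<in>UNIV. ln (normal_density 0 (sqrt (t i)) (e i \<bullet> (v - u))))" for v
    unfolding frame_normal_def using pos by (subst ln_prod) (auto simp: less_le)
  also have "\<dots> v = - 3 / 2 * ln (2 * pi) - 1 / 2 * (\<Sum>i\<in>UNIV. ln (t i))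
        - 1 / 2 * (\<Sum>i\<in>UNIV. (e i \<bullet> (v - u))\<^sup>2 / t i)" for v
    unfolding nd by (simp add: sum_subtractf sum_distrib_left sum_negf)
  finally have N: "ln (frame_normal e t u v) = - 3 / 2 * ln (2 * pi) - 1 / 2 * (\<Sum>i\<in>UNIV. ln (t i))
        - 1 / 2 * (\<Sum>i\<in>UNIV. (e i \<bullet> (v - u))\<^sup>2 / t i)" for v .
  have L: "Lambda d > 0" by (rule Lambda_pos[OF d])
  have "ln (internal_density d T I) = ln (Lambda d) - d / 2 * ln T - I powr (2 / d) / T" for I
    unfolding internal_density_def using L T by (simp add: ln_mult ln_div ln_powr)
  then show ?thesis
    unfolding frame_maxwellian_def
    using r L frame_normal_pos[where t=t and e=e and u=u and v="fst z", OF t] internal_density_pos[OF d T, of "snd z"]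
    by (simp add: ln_mult N)
qed

text \<open>
  The logarithm of a Gaussian is a combination of exactly the weights in \<open>has_moments\<close>. With
  \<open>g\<close> the Gaussian itself this computes its entropy, and with \<open>g\<close> the distribution function it
  computes a cross entropy.
\<close>

lemma cross_entropy_frame_maxwellian:
  assumes g: "has_moments d e u r l S g"
    and pos: "c > 0" "d > 0" "\<And>i. t i > 0" "T > 0"
  shows "has_bochner_integral phase (\<lambda>z. g z * ln (frame_maxwellian c d e t u T z))
    (r * (ln (c * Lambda d) - 3 / 2 * ln (2 * pi)
          - 1 / 2 * (\<Sum>i\<in>UNIV. ln (t i) + l i / t i) - d / 2 * (ln T + S / T)))"
proof -
  define k where "k = ln (c * Lambda d) - 3 / 2 * ln (2 * pi) - 1 / 2 * (\<Sum>i\<in>UNIV. ln (t i)) - d / 2 * ln T"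
  have 1: "has_bochner_integral phase (\<lambda>z. k * g z) (k * r)"
    using g by (intro has_bochner_integral_mult_right) (auto simp: has_moments_def)
  have 2: "has_bochner_integral phase
      (\<lambda>z. \<Sum>i\<in>UNIV. (1 / 2 / t i) * ((e i \<bullet> (fst z - u))\<^sup>2 * g z))
      (\<Sum>i\<in>UNIV. (1 / 2 / t i) * (r * l i))"
    using g by (intro has_bochner_integral_sum has_bochner_integral_mult_right)
      (auto simp: has_moments_def)
  have 3: "has_bochner_integral phase (\<lambda>z. (1 / T) * (snd z powr (2 / d) * g z))
      ((1 / T) * (r * (d / 2 * S)))"
    using g by (intro has_bochner_integral_mult_right) (auto simp: has_moments_def)
  have eq: "g z * ln (frame_maxwellian c d e t u T z)
    = k * g z - (\<Sum>i\<in>UNIV. (1 / 2 / t i) * ((e i \<bullet> (fst z - u))\<^sup>2 * g z))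
      - (1 / T) * (snd z powr (2 / d) * g z)" for z
    unfolding ln_frame_maxwellian[where t=t, OF pos] k_def[symmetric]
    by (simp add: algebra_simps sum_distrib_left sum_distrib_right)
  have val: "r * (ln (c * Lambda d) - 3 / 2 * ln (2 * pi)
          - 1 / 2 * (\<Sum>i\<in>UNIV. ln (t i) + l i / t i) - d / 2 * (ln T + S / T))
    = k * r - (\<Sum>i\<in>UNIV. (1 / 2 / t i) * (r * l i)) - (1 / T) * (r * (d / 2 * S))"
    by (simp add: k_def algebra_simps sum.distrib sum_distrib_left sum_distrib_right)
  show ?thesis
    unfolding eq val by (intro has_bochner_integral_diff 1 2 3)
qed

section \<open>The Gibbs inequality and extended logarithms\<close>

text \<open>
  Pointwise \<open>g ln (h / g) \<le> h - g\<close>, and the right-hand side integrates to zero.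
\<close>

lemma gibbs_inequality:
  fixes g h :: "'a \<Rightarrow> real"
  assumes g: "has_bochner_integral M g r" and h: "has_bochner_integral M h r"
    and g0: "AE z in M. g z \<ge> 0" and h0: "AE z in M. h z > 0"
    and gg: "integrable M (\<lambda>z. g z * ln (g z))" and gh: "integrable M (\<lambda>z. g z * ln (h z))"
  shows "(LINT z|M. g z * ln (h z)) \<le> (LINT z|M. g z * ln (g z))"
proof -
  have "(LINT z|M. g z * ln (h z)) \<le> (LINT z|M. g z * ln (g z) + (h z - g z))"
  proof (rule integral_mono_AE)
    show "AE z in M. g z * ln (h z) \<le> g z * ln (g z) + (h z - g z)"
      using g0 h0
    proof eventually_elim
      case (elim z)
      show ?case
      \<comment> \<open>Where \<open>g z = 0\<close> the claim reduces to \<open>0 \<le> h z\<close>.\<close>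
      proof (cases "g z = 0")
        case False
        then have gp: "g z > 0" using elim by simp
        have "ln (h z / g z) \<le> h z / g z - 1"
          using gp elim by (intro ln_le_minus_one) auto
        then have "g z * ln (h z / g z) \<le> g z * (h z / g z - 1)"
          using gp by (intro mult_left_mono) auto
        then show ?thesis using gp elim by (simp add: ln_div right_diff_distrib)
      qed (use elim in simp)
    qed
  qed (use g h gg gh in \<open>auto simp: has_bochner_integral_iff\<close>)
  also have "\<dots> = (LINT z|M. g z * ln (g z))"
    using g h gg by (simp add: has_bochner_integral_iff)
  finally show ?thesis .
qed

text \<open>
  An integrable extended function is finite almost everywhere, and \<open>g ln f\<close> is infinite exactly
  where \<open>f\<close> vanishes and \<open>g\<close> does not. Off this null set it agrees with the product with the real
  logarithm.
\<close>

lemma ext_integrable_times_ln: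
  assumes [measurable]: "g \<in> borel_measurable M" "f \<in> borel_measurable M"
    and ext: "ext_integrable M (\<lambda>z. ereal (g z) * ext_ln (f z))"
  shows "integrable M (\<lambda>z. g z * ln (f z))" and "AE z in M. f z = 0 \<longrightarrow> g z = 0"
proof -
  let ?F = "\<lambda>z. ereal (g z) * ext_ln (f z)"
  have [measurable]: "?F \<in> borel_measurable M" and fin: "(\<integral>\<^sup>+ z. e2ennreal \<bar>?F z\<bar> \<partial>M) < \<infinity>"
    using ext by (auto simp: ext_integrable_def)
  have "(\<lambda>z. e2ennreal \<bar>?F z\<bar>) \<in> borel_measurable M"
    by (intro measurable_compose[OF _ measurable_e2ennreal] borel_measurable_ereal_abs) measurable
  then have "AE z in M. e2ennreal \<bar>?F z\<bar> \<noteq> \<infinity>"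
    by (rule nn_integral_PInf_AE) (use fin in auto)
  then show ae: "AE z in M. f z = 0 \<longrightarrow> g z = 0"
    by eventually_elim (auto simp: ext_ln_def split: if_splits)
  have "(\<integral>\<^sup>+ z. ennreal (norm (g z * ln (f z))) \<partial>M) = (\<integral>\<^sup>+ z. e2ennreal \<bar>?F z\<bar> \<partial>M)"
    by (rule nn_integral_cong_AE, use ae in eventually_elim)
       (auto simp: ext_ln_def e2ennreal_ereal abs_mult ennreal_mult zero_ereal_def)
  then show "integrable M (\<lambda>z. g z * ln (f z))"
    using fin by (intro integrableI_bounded) auto
qed

section \<open>Concavity of the logarithm on the eigenvalues\<close>

lemma ln_mix:
  fixes a b w :: real
  assumes "a > 0" "b > 0" "0 \<le> w" "w \<le> 1"
  shows "w * ln a + (1 - w) * ln b \<le> ln (w * a + (1 - w) * b)"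
  using concave_onD[OF ln_concave, of "1 - w" a b] assms by simp

lemma ln_mix3:
  fixes a b c :: real
  assumes "a > 0" "b > 0" "c > 0" "0 \<le> w" "w \<le> 1"
  shows "w * ln a + (1 - w) / 2 * (ln b + ln c) \<le> ln (w * a + (1 - w) / 2 * (b + c))"
proof -
  have "1 / 2 * ln b + 1 / 2 * ln c \<le> ln (1 / 2 * b + 1 / 2 * c)"
    using ln_mix[of b c "1 / 2"] assms by simp
  then have "(1 - w) * (1 / 2 * ln b + 1 / 2 * ln c) \<le> (1 - w) * ln (1 / 2 * b + 1 / 2 * c)"
    using assms by (intro mult_left_mono) auto
  moreover have "w * ln a + (1 - w) * ln (1 / 2 * b + 1 / 2 * c) \<le> ln (w * a + (1 - w) * (1 / 2 * b + 1 / 2 * c))"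
    using assms by (intro ln_mix) auto
  ultimately show ?thesis by (simp add: field_simps)
qed

lemma sum_ln_le_ln_mean:
  fixes l :: "3 \<Rightarrow> real"
  assumes l: "\<And>i. l i > 0" and T: "3 * T = (\<Sum>i\<in>UNIV. l i)"
  shows "(\<Sum>i\<in>UNIV. ln (l i)) \<le> 3 * ln T"
proof -
  have "T = 1 / 3 * l 1 + (1 - 1 / 3) / 2 * (l 2 + l 3)"
    using T by (simp add: sum_3 field_simps)
  then have "1 / 3 * ln (l 1) + (1 - 1 / 3) / 2 * (ln (l 2) + ln (l 3)) \<le> ln T"
    using ln_mix3[OF l l l, of "1 / 3" 1 2 3] by simp
  then show ?thesis unfolding sum_3 by (simp add: field_simps)
qed

text \<open>
  Every relaxed eigenvalue is a convex combination in which the mean \<open>T\<close> has weight \<open>m\<close>. For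
  \<open>n \<ge> 0\<close> it is \<open>(1 - n) T + n l i\<close> as it stands. For \<open>n < 0\<close> the trace condition replaces \<open>l i\<close>
  by \<open>3 T\<close> minus the other two eigenvalues, which gives \<open>(1 + 2 n) T - n (l j + l k)\<close>. Summed over
  \<open>i\<close>, each logarithm \<open>ln (l j)\<close> then receives the total weight \<open>1 - m\<close>.
\<close>

lemma sum_ln_relaxed_eigenvalues:
  fixes l :: "3 \<Rightarrow> real"
  assumes l: "\<And>i. l i > 0" and T: "3 * T = (\<Sum>i\<in>UNIV. l i)"
    and n: "- (1 / 2) < n" "n < 1"
  defines "m \<equiv> min (1 - n) (1 + 2 * n)"
  shows "m * (3 * ln T) + (1 - m) * (\<Sum>i\<in>UNIV. ln (l i))
    \<le> (\<Sum>i\<in>UNIV. ln ((1 - n) * T + n * l i))"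
proof -
  have T': "3 * T = l 1 + l 2 + l 3" using T by (simp add: sum_3)
  then have Tp: "T > 0" using l[of 1] l[of 2] l[of 3] by linarith
  show ?thesis
  proof (cases "n \<ge> 0")
    case True
    have "(1 - n) * ln T + (1 - (1 - n)) * ln (l i) \<le> ln ((1 - n) * T + (1 - (1 - n)) * l i)" for i
      using True n Tp l by (intro ln_mix) auto
    then have "(1 - n) * ln T + n * ln (l i) \<le> ln ((1 - n) * T + n * l i)" for i
      by simp
    from this[of 1] this[of 2] this[of 3] show ?thesis
      using True by (simp add: m_def sum_3 algebra_simps)
  next
    case False
    have m: "m = 1 + 2 * n" using False by (simp add: m_def)
    have *: "m * ln T + (1 - m) / 2 * (ln a + ln b) \<le> ln ((1 - n) * T + n * c)"
      if "a > 0" "b > 0" "3 * T = a + b + c" for a b c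
    proof -
      have c: "c = 3 * T - a - b" using that by simp
      have "(1 - n) * T + n * c = m * T + (1 - m) / 2 * (a + b)"
        by (simp add: c m field_simps)
      then show ?thesis using ln_mix3[of T a b m] Tp that n False m by simp
    qed
    from *[of "l 2" "l 3" "l 1"] *[of "l 1" "l 3" "l 2"] *[of "l 1" "l 2" "l 3"] l T'
    have "3 * (m * ln T) + (1 - m) / 2 * (ln (l 2) + ln (l 3)) + (1 - m) / 2 * (ln (l 1) + ln (l 3))
        + (1 - m) / 2 * (ln (l 1) + ln (l 2))
      \<le> ln ((1 - n) * T + n * l 1) + ln ((1 - n) * T + n * l 2) + ln ((1 - n) * T + n * l 3)"
      by fastforce
    then show ?thesis by (simp add: sum_3 field_simps)
  qed
qed

section \<open>The macroscopic quantities of a distribution function\<close>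

lemma space_phase: "space phase = UNIV \<times> {0..}"
  by (simp add: phase_def)

lemma borel_measurable_phase:
  fixes q :: "(real^3) \<times> real \<Rightarrow> 'b::euclidean_space"
  assumes "q \<in> borel_measurable borel"
  shows "q \<in> borel_measurable phase"
  unfolding phase_def
  by (intro measurable_restrict_space1 measurable_completion) (use assms in simp)

text \<open>
  All moments of \<open>f\<close> up to second order, including vector- and matrix-valued ones, are dominated by
  the weight of the integrability hypothesis.
\<close>

lemma integrable_phase_weighted:
  fixes q :: "(real^3) \<times> real \<Rightarrow> 'b::euclidean_space" and f :: "(real^3) \<times> real \<Rightarrow> real"
  assumes f: "f \<in> borel_measurable phase"
    and int: "integrable phase (\<lambda>z. (1 + (norm (fst z))\<^sup>2 + snd z powr p) * f z)"
    and q: "q \<in> borel_measurable borel"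
    and le: "\<And>z. norm (q z) \<le> C * (1 + (norm (fst z))\<^sup>2 + snd z powr p)"
  shows "integrable phase (\<lambda>z. f z *\<^sub>R q z)"
proof (rule Bochner_Integration.integrable_bound)
  show "integrable phase (\<lambda>z. C * ((1 + (norm (fst z))\<^sup>2 + snd z powr p) * f z))"
    using int by (rule integrable_mult_right)
  show "(\<lambda>z. f z *\<^sub>R q z) \<in> borel_measurable phase"
    using f borel_measurable_phase[OF q] by (rule borel_measurable_scaleR)
  have "norm (f z *\<^sub>R q z) \<le> norm (C * ((1 + (norm (fst z))\<^sup>2 + snd z powr p) * f z))" for z
  proof -
    have "\<bar>f z\<bar> * norm (q z) \<le> \<bar>f z\<bar> * (C * (1 + (norm (fst z))\<^sup>2 + snd z powr p))"
      by (intro mult_left_mono le) auto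
    also have "\<dots> \<le> \<bar>f z\<bar> * \<bar>C * (1 + (norm (fst z))\<^sup>2 + snd z powr p)\<bar>"
      by (intro mult_left_mono) auto
    finally show ?thesis by (simp add: abs_mult mult_ac)
  qed
  then show "AE z in phase. norm (f z *\<^sub>R q z) \<le> norm (C * ((1 + (norm (fst z))\<^sup>2 + snd z powr p) * f z))"
    by simp
qed

lemma norm_diff_sq_le: "(norm (v - u))\<^sup>2 \<le> (2 + 2 * (norm u)\<^sup>2) * (1 + (norm v)\<^sup>2 + I powr p)"
  for v u :: "'a::real_inner"
proof -
  have "(norm (v - u))\<^sup>2 \<le> (norm v + norm u)\<^sup>2"
    by (intro power_mono norm_triangle_ineq4) simp
  also have "\<dots> \<le> 2 * (norm v)\<^sup>2 + 2 * (norm u)\<^sup>2"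
    using sum_squares_bound[of "norm v" "norm u"] by (simp add: power2_sum)
  also have "\<dots> \<le> (2 + 2 * (norm u)\<^sup>2) * (1 + (norm v)\<^sup>2 + I powr p)"
    by (simp add: algebra_simps)
  finally show ?thesis .
qed

lemma norm_outer: "norm (outer a a) = (norm a)\<^sup>2"
proof -
  have "outer a a \<bullet> outer a a = (a \<bullet> a) * (a \<bullet> a)"
    by (simp add: outer_def inner_vec_def sum_distrib_left sum_distrib_right mult_ac)
  then show ?thesis by (simp add: norm_eq_sqrt_inner power2_eq_square)
qed

lemma inner_outer_mult: "x \<bullet> (outer a b *v y) = (x \<bullet> a) * (b \<bullet> y)"
  by (simp add: outer_def matrix_vector_mult_def inner_vec_def sum_3 algebra_simps)

text \<open>
  The hypotheses on \<open>f\<close> under which the macroscopic quantities are defined by convergent integrals.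
\<close>

locale phase_density =
  fixes \<delta> :: real and f :: "(real^3) \<times> real \<Rightarrow> real"
  assumes \<delta>: "\<delta> > 0"
    and f_meas [measurable]: "f \<in> borel_measurable phase"
    and f_nonneg: "\<And>v I. I \<ge> 0 \<Longrightarrow> f (v, I) \<ge> 0"
    and f_int: "integrable phase (\<lambda>z. (1 + (norm (fst z))\<^sup>2 + snd z powr (2 / \<delta>)) * f z)"
    and rho_pos: "rho f > 0"
begin

lemma AE_nonneg: "AE z in phase. f z \<ge> 0"
  using f_nonneg by (auto simp: space_phase intro!: AE_I2)

lemma integrable_f: "integrable phase f"
  using integrable_phase_weighted[OF f_meas f_int, of "\<lambda>_. 1::real" 1] by simp

lemma rho_eq: "rho f = integral\<^sup>L phase f"
  by (simp add: rho_def)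

lemma integrable_internal: "integrable phase (\<lambda>z. snd z powr (2 / \<delta>) * f z)"
proof -
  have "(\<lambda>z::(real^3)\<times>real. snd z powr (2 / \<delta>)) \<in> borel_measurable borel"
    unfolding borel_prod[symmetric] by measurable
  then show ?thesis
    using integrable_phase_weighted[OF f_meas f_int, of "\<lambda>z. snd z powr (2 / \<delta>)" 1]
    by (simp add: mult.commute)
qed

lemma integrable_kinetic: "integrable phase (\<lambda>z. (norm (fst z - u))\<^sup>2 * f z)"
proof -
  have "(\<lambda>z::(real^3)\<times>real. (norm (fst z - u))\<^sup>2) \<in> borel_measurable borel"
    by (intro borel_measurable_continuous_onI continuous_intros)
  then have "integrable phase (\<lambda>z. f z *\<^sub>R (norm (fst z - u))\<^sup>2)"
    by (rule integrable_phase_weighted[OF f_meas f_int, where C="2 + 2 * (norm u)\<^sup>2"])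
       (simp add: norm_diff_sq_le)
  then show ?thesis by (simp add: mult.commute)
qed

lemma integrable_outer: "integrable phase (\<lambda>z. f z *\<^sub>R outer (fst z - u) (fst z - u))"
proof -
  have "(\<lambda>z::(real^3)\<times>real. outer (fst z - u) (fst z - u)) \<in> borel_measurable borel"
    unfolding outer_def by (intro borel_measurable_continuous_onI continuous_intros)
  then show ?thesis
    by (rule integrable_phase_weighted[OF f_meas f_int, where C="2 + 2 * (norm u)\<^sup>2"])
       (simp add: norm_outer norm_diff_sq_le)
qed

text \<open>
  The quadratic form of the pressure tensor is a bounded linear functional of the matrix, so it
  may be taken inside the matrix-valued integral.
\<close>

lemma Theta_form:
  "integrable phase (\<lambda>z. (x \<bullet> (fst z - U f)) * (y \<bullet> (fst z - U f)) * f z)"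
  "x \<bullet> (Theta f *v y) = (1 / rho f) * (LINT z|phase. (x \<bullet> (fst z - U f)) * (y \<bullet> (fst z - U f)) * f z)"
proof -
  let ?O = "\<lambda>z. f z *\<^sub>R outer (fst z - U f) (fst z - U f)"
  have bl: "bounded_linear (\<lambda>A :: real^3^3. x \<bullet> (A *v y))"
    unfolding linear_conv_bounded_linear[symmetric]
    by (intro linearI)
       (simp_all add: matrix_vector_mult_add_rdistrib inner_add_right scaleR_matrix_vector_assoc[symmetric])
  have O: "x \<bullet> (?O z *v y) = (x \<bullet> (fst z - U f)) * (y \<bullet> (fst z - U f)) * f z" for z
    by (simp add: scaleR_matrix_vector_assoc[symmetric] inner_outer_mult inner_commute mult_ac)
  show "integrable phase (\<lambda>z. (x \<bullet> (fst z - U f)) * (y \<bullet> (fst z - U f)) * f z)"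
    using integrable_bounded_linear[OF bl integrable_outer[of "U f"]] unfolding O .
  have T: "Theta f = (1 / rho f) *\<^sub>R (LINT z|phase. ?O z)"
    by (simp add: Theta_def case_prod_beta')
  have "x \<bullet> (Theta f *v y) = (1 / rho f) * (x \<bullet> ((LINT z|phase. ?O z) *v y))"
    unfolding T by (simp add: scaleR_matrix_vector_assoc[symmetric])
  also have "x \<bullet> ((LINT z|phase. ?O z) *v y) = (LINT z|phase. x \<bullet> (?O z *v y))"
    using integral_bounded_linear[OF bl integrable_outer[of "U f"]] by simp
  finally show "x \<bullet> (Theta f *v y) = (1 / rho f) * (LINT z|phase. (x \<bullet> (fst z - U f)) * (y \<bullet> (fst z - U f)) * f z)"
    unfolding O .
qed

text \<open>
  If the form vanished at \<open>x\<close>, then \<open>f\<close> would vanish almost everywhere off the hyperplane of the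
  points \<open>(v, I)\<close> with \<open>x \<bullet> v = x \<bullet> U f\<close>. That hyperplane is a null set, so \<open>f\<close> would have no mass.
\<close>

lemma Theta_pos_def:
  assumes "x \<noteq> 0" shows "x \<bullet> (Theta f *v x) > 0"
proof -
  let ?g = "\<lambda>z. (x \<bullet> (fst z - U f)) * (x \<bullet> (fst z - U f)) * f z"
  have nn: "AE z in phase. ?g z \<ge> 0"
    using AE_nonneg by eventually_elim simp
  have "integral\<^sup>L phase ?g \<noteq> 0"
  proof
    assume "integral\<^sup>L phase ?g = 0"
    then have z: "AE z in phase. ?g z = 0"
      using integral_nonneg_eq_0_iff_AE[OF Theta_form(1) nn] by simp
    have "negligible {z. (x, 0::real) \<bullet> z = x \<bullet> U f}"
      using assms by (intro negligible_hyperplane) (simp add: zero_prod_def)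
    then have "AE z in lebesgue. z \<notin> {z. (x, 0::real) \<bullet> z = x \<bullet> U f}"
      unfolding negligible_iff_null_sets by (rule AE_not_in)
    then have "AE z in phase. x \<bullet> (fst z - U f) \<noteq> 0"
      unfolding phase_def using phase_sets
      by (subst AE_restrict_space_iff) (auto simp: inner_prod_def inner_diff_right)
    with z have "AE z in phase. f z = 0"
      by eventually_elim auto
    then have "integral\<^sup>L phase f = 0"
      by (subst integral_cong_AE[where g="\<lambda>_. 0"]) auto
    then show False using rho_pos by (simp add: rho_eq)
  qed
  moreover have "integral\<^sup>L phase ?g \<ge> 0"
    using nn by (rule integral_nonneg_AE)
  ultimately show ?thesis
    unfolding Theta_form(2) using rho_pos by (simp add: less_le)
qed

lemma E_tr_eq: "E_tr f = (1 / rho f) * ((LINT z|phase. (norm (fst z - U f))\<^sup>2 * f z) / 2)"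
  by (simp add: E_tr_def case_prod_beta')

lemma E_int_eq: "E_int \<delta> f = (1 / rho f) * (LINT z|phase. snd z powr (2 / \<delta>) * f z)"
  by (simp add: E_int_def case_prod_beta')

lemma E_tot_eq: "E_tot \<delta> f = E_tr f + E_int \<delta> f"
proof -
  have "(LINT z|phase. ((norm (fst z - U f))\<^sup>2 / 2 + snd z powr (2 / \<delta>)) * f z)
    = (LINT z|phase. ((norm (fst z - U f))\<^sup>2 * f z) / 2 + snd z powr (2 / \<delta>) * f z)"
    by (intro Bochner_Integration.integral_cong) (auto simp: algebra_simps)
  also have "\<dots> = (LINT z|phase. (norm (fst z - U f))\<^sup>2 * f z) / 2
      + (LINT z|phase. snd z powr (2 / \<delta>) * f z)"
    using integrable_kinetic[of "U f"] integrable_internal by simp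
  finally show ?thesis
    by (simp add: E_tot_def case_prod_beta' E_tr_eq E_int_eq distrib_left)
qed

lemma T_tot_eq: "(3 + \<delta>) * T_tot \<delta> f = 3 * T_tr f + \<delta> * T_int \<delta> f"
  using \<delta> by (simp add: T_tot_def T_tr_def T_int_def E_tot_eq field_simps)

text \<open>
  The directional temperatures of \<open>f\<close> along the eigenvectors of \<open>Theta f\<close> are its eigenvalues; by
  Parseval they add up to \<open>3 T_tr\<close>.
\<close>

lemma Theta_eigenframe:
  obtains e l where "orthonormal_frame e" "\<And>i. Theta f *v e i = l i *\<^sub>R e i" "\<And>i. l i > 0"
    "3 * T_tr f = (\<Sum>i\<in>UNIV. l i)" "has_moments \<delta> e (U f) (rho f) l (T_int \<delta> f) f"
proof -
  have "x \<bullet> (Theta f *v y) = (Theta f *v x) \<bullet> y" for x y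
    using Theta_form(2)[of x y] Theta_form(2)[of y x] by (simp add: inner_commute mult.commute)
  then obtain e l where e: "orthonormal_frame e" and l: "\<And>i. Theta f *v e i = l i *\<^sub>R e i"
    using symmetric_matrix_eigenframe by blast
  have li: "l i = e i \<bullet> (Theta f *v e i)" for i
    by (simp add: l frame_inner[OF e])
  have mom: "has_bochner_integral phase (\<lambda>z. (e i \<bullet> (fst z - U f))\<^sup>2 * f z) (rho f * l i)" for i
    using Theta_form[of "e i" "e i"] rho_pos
    by (simp add: has_bochner_integral_iff li power2_eq_square)
  have "e i \<noteq> 0" for i using frame_inner[OF e, of i i] by auto
  then have lp: "l i > 0" for i
    by (subst li) (rule Theta_pos_def)
  have "has_bochner_integral phase (\<lambda>z. \<Sum>i\<in>UNIV. (e i \<bullet> (fst z - U f))\<^sup>2 * f z) (\<Sum>i\<in>UNIV. rho f * l i)"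
    using mom by (intro has_bochner_integral_sum) auto
  then have "has_bochner_integral phase (\<lambda>z. (norm (fst z - U f))\<^sup>2 * f z) (rho f * (\<Sum>i\<in>UNIV. l i))"
    by (simp add: sum_distrib_right[symmetric] sum_distrib_left[symmetric] frame_parseval[OF e])
  then have "3 * T_tr f = (\<Sum>i\<in>UNIV. l i)"
    using rho_pos by (simp add: T_tr_def E_tr_eq has_bochner_integral_iff)
  moreover have "has_moments \<delta> e (U f) (rho f) l (T_int \<delta> f) f"
    unfolding has_moments_def
    using mom integrable_f integrable_internal rho_pos \<delta>
    by (auto simp: has_bochner_integral_iff rho_eq[symmetric] T_int_def E_int_eq)
  ultimately show thesis using that e l lp by blast
qed

end

lemma sqrt_prod: "sqrt (prod g A) = (\<Prod>i\<in>A. sqrt (g i))"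
  by (induction A rule: infinite_finite_induct) (auto simp: real_sqrt_mult)

text \<open>
  An eigenframe of \<open>Theta f\<close> diagonalises every \<open>T_tensor\<close>, which splits determinant and quadratic
  form of the Gaussian into one factor and one term per direction.
\<close>

lemma gaussian_eq_frame_maxwellian:
  assumes e: "orthonormal_frame e" and l: "\<And>i. Theta f *v e i = l i *\<^sub>R e i"
    and t_def: "\<And>i. t i = \<theta> * T_tot \<delta> f + (1 - \<theta>) * ((1 - \<nu>) * T_tr f + \<nu> * l i)"
    and t: "\<And>i. t i > 0"
  shows "gaussian \<delta> \<nu> \<theta> f = frame_maxwellian (rho f) \<delta> e t (U f) (T_relax \<delta> \<theta> f)"
proof (rule ext)
  fix z :: "(real^3) \<times> real"
  let ?A = "T_tensor \<delta> \<nu> \<theta> f"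
  have A: "?A *v e i = t i *\<^sub>R e i" for i
    by (simp add: T_tensor_def t_def matrix_vector_mult_add_rdistrib
        scaleR_matrix_vector_assoc[symmetric] l algebra_simps)
  have t0: "t i \<noteq> 0" for i using t[of i] by simp
  have "((2 * pi) *\<^sub>R ?A) *v e i = (2 * pi * t i) *\<^sub>R e i" for i
    by (simp add: scaleR_matrix_vector_assoc[symmetric] A)
  then have det: "det ((2 * pi) *\<^sub>R ?A) = (\<Prod>i\<in>UNIV. 2 * pi * t i)"
    by (rule eigenframe_det[OF e]) (use t0 in simp)
  have "frame_normal e t (U f) v = 1 / sqrt (\<Prod>i\<in>UNIV. 2 * pi * t i)
      * exp (- (1 / 2) * (\<Sum>i\<in>UNIV. (e i \<bullet> (v - U f))\<^sup>2 / t i))" for v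
    using t by (simp add: frame_normal_def normal_density_def less_imp_le prod.distrib prod_dividef
        exp_sum sqrt_prod[symmetric] sum_distrib_left)
  moreover have "exp (a - b) = exp a * exp (- b)" for a b :: real
    by (simp add: exp_diff exp_minus divide_inverse)
  ultimately show "gaussian \<delta> \<nu> \<theta> f z = frame_maxwellian (rho f) \<delta> e t (U f) (T_relax \<delta> \<theta> f) z"
    unfolding gaussian_def frame_maxwellian_def internal_density_def case_prod_beta'
      det eigenframe_inverse_form[OF e A t0]
    by simp
qed

section \<open>Entropy estimates\<close>

context phase_density begin

text \<open>
  Where \<open>f = 0\<close> both integrands vanish; elsewhere the logarithm of the quotient splits.
\<close>

lemma rel_entropy_frame_maxwellian:
  assumes mom: "has_moments \<delta> e u (rho f) l S f"
    and Hf: "integrable phase (\<lambda>z. f z * ln (f z))"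
    and t: "\<And>i. t i > 0" and T: "T > 0"
  shows "rel_entropy f (frame_maxwellian (rho f) \<delta> e t u T)
    = (LINT z|phase. f z * ln (f z))
      - rho f * (ln (rho f * Lambda \<delta>) - 3 / 2 * ln (2 * pi)
          - 1 / 2 * (\<Sum>i\<in>UNIV. ln (t i) + l i / t i) - \<delta> / 2 * (ln T + S / T))"
proof -
  let ?G = "frame_maxwellian (rho f) \<delta> e t u T"
  have G: "?G z > 0" for z
    by (rule frame_maxwellian_pos[where t=t, OF rho_pos \<delta> t T])
  have "f z * ln (f z / ?G z) = f z * ln (f z) - f z * ln (?G z)" if "z \<in> space phase" for z
    using G[of z] that f_nonneg[of "snd z" "fst z"]
    by (cases "f z = 0") (auto simp: ln_div space_phase right_diff_distrib)
  then have "rel_entropy f ?G = (LINT z|phase. f z * ln (f z) - f z * ln (?G z))"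
    unfolding rel_entropy_def by (intro Bochner_Integration.integral_cong) auto
  then show ?thesis
    using cross_entropy_frame_maxwellian[where t=t, OF mom rho_pos \<delta> t T] Hf
    by (simp add: has_bochner_integral_iff)
qed

text \<open>
  Among all functions with the same moments the Gaussian has the least \<open>H\<close>: its cross entropy
  with \<open>f\<close> equals its own entropy, and Gibbs compares the former with \<open>H(f)\<close>.
\<close>

lemma entropy_ge_matched_maxwellian:
  assumes e: "orthonormal_frame e" and mom: "has_moments \<delta> e u (rho f) l S f"
    and Hf: "integrable phase (\<lambda>z. f z * ln (f z))"
    and l: "\<And>i. l i > 0" and S: "S > 0"
  shows "rho f * (ln (rho f * Lambda \<delta>) - 3 / 2 * ln (2 * pi) - (3 + \<delta>) / 2
          - (1 / 2 * (\<Sum>i\<in>UNIV. ln (l i)) + \<delta> / 2 * ln S))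
      \<le> (LINT z|phase. f z * ln (f z))"
proof -
  let ?G = "frame_maxwellian (rho f) \<delta> e l u S"
  note cross = cross_entropy_frame_maxwellian[where t=l, OF mom rho_pos \<delta> l S]
  have "(LINT z|phase. f z * ln (?G z)) \<le> (LINT z|phase. f z * ln (f z))"
  proof (rule gibbs_inequality)
    show "has_bochner_integral phase f (rho f)" using mom by (simp add: has_moments_def)
    show "has_bochner_integral phase ?G (rho f)"
      using frame_maxwellian_has_moments[where t=l, OF e \<delta> l S] by (simp add: has_moments_def)
    show "AE z in phase. ?G z > 0"
      using frame_maxwellian_pos[where t=l, OF rho_pos \<delta> l S] by simp
  qed (use AE_nonneg Hf cross in \<open>auto simp: has_bochner_integral_iff\<close>)
  moreover have "(\<Sum>i\<in>UNIV. ln (l i) + l i / l i) = (\<Sum>i\<in>UNIV. ln (l i)) + 3"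
    using l by (simp add: sum.distrib less_imp_neq[THEN not_sym])
  ultimately show ?thesis
    using cross S by (simp add: has_bochner_integral_iff field_simps)
qed

text \<open>
  Integrability of \<open>M ln f\<close> with the extended logarithm makes \<open>f\<close> positive almost everywhere, as
  \<open>M\<close> is positive everywhere. So Gibbs applies with the roles exchanged: the integral of \<open>M ln f\<close>
  is at most \<open>H(M)\<close>.
\<close>

lemma entropy_production_ge:
  assumes e: "orthonormal_frame e"
    and t: "\<And>i. t i > 0" and T: "T > 0"
    and M: "gaussian \<delta> \<nu> \<theta> f = frame_maxwellian (rho f) \<delta> e t (U f) T"
    and A: "A_coef \<delta> \<mu> \<nu> \<theta> f \<ge> 0"
    and Hf: "integrable phase (\<lambda>z. f z * ln (f z))"
    and ext: "ext_integrable phase (\<lambda>z. ereal (gaussian \<delta> \<nu> \<theta> f z) * ext_ln (f z))"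
  shows "A_coef \<delta> \<mu> \<nu> \<theta> f * ((LINT z|phase. f z * ln (f z))
      - rho f * (ln (rho f * Lambda \<delta>) - 3 / 2 * ln (2 * pi) - (3 + \<delta>) / 2
          - (1 / 2 * (\<Sum>i\<in>UNIV. ln (t i)) + \<delta> / 2 * ln T)))
    \<le> entropy_production \<delta> \<mu> \<nu> \<theta> f"
proof -
  let ?M = "gaussian \<delta> \<nu> \<theta> f"
  let ?A = "A_coef \<delta> \<mu> \<nu> \<theta> f"
  have Mpos: "?M z > 0" for z
    unfolding M by (rule frame_maxwellian_pos[where t=t, OF rho_pos \<delta> t T])
  have momM: "has_moments \<delta> e (U f) (rho f) t T ?M"
    unfolding M by (rule frame_maxwellian_has_moments[where t=t, OF e \<delta> t T])
  then have intM: "has_bochner_integral phase ?M (rho f)" by (simp add: has_moments_def)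
  then have Mm: "?M \<in> borel_measurable phase"
    by (auto simp: has_bochner_integral_iff dest: borel_measurable_integrable)
  note Mlnf = ext_integrable_times_ln[OF Mm f_meas ext]
  note self = cross_entropy_frame_maxwellian[where t=t, OF momM rho_pos \<delta> t T, folded M]
  have "AE z in phase. f z > 0"
    using AE_nonneg Mlnf(2) by eventually_elim (use Mpos in \<open>force simp: less_le\<close>)
  then have "(LINT z|phase. ?M z * ln (f z)) \<le> (LINT z|phase. ?M z * ln (?M z))"
    using intM integrable_f rho_eq Mlnf(1) self Mpos
    by (intro gibbs_inequality[where r="rho f"])
       (auto simp: has_bochner_integral_iff less_imp_le)
  also have "\<dots> = rho f * (ln (rho f * Lambda \<delta>) - 3 / 2 * ln (2 * pi) - (3 + \<delta>) / 2
          - (1 / 2 * (\<Sum>i\<in>UNIV. ln (t i)) + \<delta> / 2 * ln T))"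
  proof -
    have "(\<Sum>i\<in>UNIV. ln (t i) + t i / t i) = (\<Sum>i\<in>UNIV. ln (t i)) + 3"
      using t by (simp add: sum.distrib less_imp_neq[THEN not_sym])
    then show ?thesis using self T by (simp add: has_bochner_integral_iff field_simps)
  qed
  finally have le: "(LINT z|phase. ?M z * ln (f z)) \<le> \<dots>" .
  have "entropy_production \<delta> \<mu> \<nu> \<theta> f
      = - (LINT z|phase. ?A * (?M z * ln (f z) - f z * ln (f z)))"
    by (simp add: entropy_production_def algebra_simps)
  also have "\<dots> = ?A * ((LINT z|phase. f z * ln (f z)) - (LINT z|phase. ?M z * ln (f z)))"
  proof -
    have "(LINT z|phase. ?A * (?M z * ln (f z) - f z * ln (f z)))
      = ?A * ((LINT z|phase. ?M z * ln (f z)) - (LINT z|phase. f z * ln (f z)))"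
      using Mlnf(1) Hf by simp
    then show ?thesis by (simp only: minus_mult_right minus_diff_eq)
  qed
  finally show ?thesis using le A by (auto intro!: mult_left_mono)
qed

end

text \<open>
  The difference of the two sides is \<open>(1 - w) (H - r (k - X)) + r (Y - (w Z + (1 - w) X))\<close>.
\<close>

lemma entropy_interpolation:
  fixes H r k w X Y Z :: real
  assumes "H \<ge> r * (k - X)" "Y \<ge> w * Z + (1 - w) * X" "r \<ge> 0" "w \<le> 1"
  shows "w * (H - r * (k - Z)) \<le> H - r * (k - Y)"
proof -
  have "0 \<le> (1 - w) * (H - r * (k - X))" using assms by simp
  moreover have "0 \<le> r * (Y - (w * Z + (1 - w) * X))" using assms by simp
  ultimately show ?thesis by (simp add: algebra_simps)
qed

theorem theorem1p1:
  fixes \<delta> \<mu> \<theta> \<nu> :: real and f :: "(real^3) \<times> real \<Rightarrow> real"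
  assumes "\<delta> > 0" and "\<mu> > 0" and "0 \<le> \<theta>" and "\<theta> \<le> 1" and "- (1 / 2) < \<nu>" and "\<nu> < 1"
    and "f \<in> borel_measurable phase"
    and "\<And>v I. I \<ge> 0 \<Longrightarrow> f (v, I) \<ge> 0"
    and "integrable phase (\<lambda>(v, I). (1 + (norm v)\<^sup>2 + I powr (2 / \<delta>)) * f (v, I))"
    and "ext_integrable phase (\<lambda>z. ereal (f z) * ext_ln (f z))"
    and "ext_integrable phase (\<lambda>z. ereal (gaussian \<delta> \<nu> \<theta> f z) * ext_ln (f z))"
    and "rho f > 0" and "T_tr f > 0" and "T_int \<delta> f > 0"
  shows "(0 < \<theta> \<longrightarrow>
            entropy_production \<delta> \<mu> \<nu> \<theta> f
              \<ge> \<theta> * A_coef \<delta> \<mu> \<nu> \<theta> f * rel_entropy f (gaussian \<delta> 0 1 f))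
       \<and> (\<theta> = 0 \<longrightarrow>
            entropy_production \<delta> \<mu> \<nu> 0 f
              \<ge> min (1 - \<nu>) (1 + 2 * \<nu>) * A_coef \<delta> \<mu> \<nu> 0 f
                  * rel_entropy f (gaussian \<delta> 0 0 f))"
proof -
  interpret phase_density \<delta> f
    by unfold_locales (use assms in \<open>auto simp: case_prod_beta'\<close>)
  let ?T = "T_tot \<delta> f" and ?Tt = "T_tr f" and ?Ti = "T_int \<delta> f"
  let ?A = "A_coef \<delta> \<mu> \<nu> \<theta> f"
  obtain e l where e: "orthonormal_frame e" and eig: "\<And>i. Theta f *v e i = l i *\<^sub>R e i"
    and l: "\<And>i. l i > 0" and tr: "3 * ?Tt = (\<Sum>i\<in>UNIV. l i)"
    and mom: "has_moments \<delta> e (U f) (rho f) l ?Ti f"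
    using Theta_eigenframe by blast
  define s where "s i = (1 - \<nu>) * ?Tt + \<nu> * l i" for i
  define t where "t i = \<theta> * ?T + (1 - \<theta>) * s i" for i
  define m where "m = min (1 - \<nu>) (1 + 2 * \<nu>)"
  define k where "k = ln (rho f * Lambda \<delta>) - 3 / 2 * ln (2 * pi) - (3 + \<delta>) / 2"
  define H where "H = (LINT z|phase. f z * ln (f z))"
  have Tp: "?T > 0"
  proof -
    have "0 < (3 + \<delta>) * ?T"
      unfolding T_tot_eq using assms(13,14) \<delta> by (intro add_pos_pos mult_pos_pos) auto
    then show ?thesis using \<delta> by (simp add: zero_less_mult_iff)
  qed
  have sp: "s i > 0" for i
  proof -
    have T3: "3 * ?Tt = l 1 + l 2 + l 3" using tr by (simp add: sum_3)
    have "l j \<le> 3 * ?Tt" for j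
      using T3 l[of 1] l[of 2] l[of 3] exhaust_3[of j] by auto
    show ?thesis
    proof (cases "\<nu> \<ge> 0")
      case True
      then show ?thesis using assms l[of i] by (simp add: s_def add_pos_nonneg)
    next
      case False
      then have "\<nu> * l i \<ge> \<nu> * (3 * ?Tt)"
        using \<open>l i \<le> 3 * ?Tt\<close> by (intro mult_left_mono_neg) auto
      moreover have "(1 - \<nu>) * ?Tt + \<nu> * (3 * ?Tt) = (1 + 2 * \<nu>) * ?Tt" by (simp add: algebra_simps)
      moreover have "(1 + 2 * \<nu>) * ?Tt > 0" using assms by (intro mult_pos_pos) auto
      ultimately show ?thesis unfolding s_def by linarith
    qed
  qed
  have convex_pos: "\<theta> * a + (1 - \<theta>) * b > 0" if "a > 0" "b > 0" for a b :: real
    using that assms(3,4) by (cases "\<theta> = 0") (auto intro: add_pos_nonneg)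
  have tp: "t i > 0" for i unfolding t_def by (rule convex_pos[OF Tp sp])
  have Rp: "T_relax \<delta> \<theta> f > 0" unfolding T_relax_def by (rule convex_pos[OF Tp assms(14)])
  have M: "gaussian \<delta> \<nu> \<theta> f = frame_maxwellian (rho f) \<delta> e t (U f) (T_relax \<delta> \<theta> f)"
    by (rule gaussian_eq_frame_maxwellian[OF e eig]) (simp_all add: t_def[symmetric] tp, simp add: t_def s_def)
  have "1 - \<nu> + \<theta> * \<nu> > 0"
    using convex_pos[of 1 "1 - \<nu>"] assms(6) by (simp add: algebra_simps)
  then have A: "?A \<ge> 0"
    unfolding A_coef_def using Tp rho_pos assms(2) by simp
  have Hf: "integrable phase (\<lambda>z. f z * ln (f z))"
    by (rule ext_integrable_times_ln(1)[OF f_meas f_meas assms(10)])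
  have D: "?A * (H - rho f * (k - (1 / 2 * (\<Sum>i\<in>UNIV. ln (t i)) + \<delta> / 2 * ln (T_relax \<delta> \<theta> f))))
      \<le> entropy_production \<delta> \<mu> \<nu> \<theta> f"
    unfolding H_def k_def by (rule entropy_production_ge[where t=t, OF e tp Rp M A Hf assms(11)])
  have Hl: "rho f * (k - (1 / 2 * (\<Sum>i\<in>UNIV. ln (l i)) + \<delta> / 2 * ln ?Ti)) \<le> H"
    unfolding H_def k_def
    by (rule entropy_ge_matched_maxwellian[where l=l, OF e mom Hf l assms(14)])
  \<comment> \<open>The last side condition says that the exponent of the isotropic Gaussian has the same mean,
    \<open>- (3 + \<delta>) / 2\<close>, under \<open>f\<close> as under the Gaussian itself. It makes the relative entropy a
    difference of entropies, with the constant \<open>k\<close> common to all Gaussians.\<close>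
  have iso: "rel_entropy f (gaussian \<delta> 0 w f)
      = H - rho f * (k - (1 / 2 * (3 * ln T0) + \<delta> / 2 * ln S))"
    if "w * ?T + (1 - w) * ?Tt = T0" "T_relax \<delta> w f = S" "T0 > 0" "S > 0"
      "3 * ?Tt / T0 + \<delta> * ?Ti / S = 3 + \<delta>" for w T0 S
  proof -
    have g: "gaussian \<delta> 0 w f = frame_maxwellian (rho f) \<delta> e (\<lambda>_. T0) (U f) S"
      using that(3) unfolding that(2)[symmetric]
      by (intro gaussian_eq_frame_maxwellian[OF e eig]) (simp_all add: that(1))
    have "(\<Sum>i\<in>(UNIV :: 3 set). ln T0 + l i / T0) = 3 * ln T0 + 3 * ?Tt / T0"
      by (simp add: sum.distrib sum_divide_distrib[symmetric] tr)
    then have "rel_entropy f (gaussian \<delta> 0 w f)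
      = H - rho f * (ln (rho f * Lambda \<delta>) - 3 / 2 * ln (2 * pi)
          - 1 / 2 * (3 * ln T0 + 3 * ?Tt / T0) - \<delta> / 2 * (ln S + ?Ti / S))"
      using rel_entropy_frame_maxwellian[where t="\<lambda>_. T0", OF mom Hf that(3,4)]
      by (simp add: g H_def)
    moreover have "1 / 2 * (3 * ln T0 + 3 * ?Tt / T0) + \<delta> / 2 * (ln S + ?Ti / S)
      = 1 / 2 * (3 * ln T0) + \<delta> / 2 * ln S + (3 + \<delta>) / 2"
      unfolding that(5)[symmetric] by (simp add: field_simps)
    ultimately show ?thesis by (simp add: k_def diff_diff_eq)
  qed
  have m: "0 \<le> m" "m \<le> 1" using assms(5,6) by (auto simp: m_def)
  have key: "m * (3 * ln ?Tt) + (1 - m) * (\<Sum>i\<in>UNIV. ln (l i)) \<le> (\<Sum>i\<in>UNIV. ln (s i))"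
    unfolding s_def m_def by (rule sum_ln_relaxed_eigenvalues[OF l tr assms(5,6)])
  have "\<theta> * ?A * rel_entropy f (gaussian \<delta> 0 1 f) \<le> entropy_production \<delta> \<mu> \<nu> \<theta> f"
  proof -
    have rel: "rel_entropy f (gaussian \<delta> 0 1 f)
        = H - rho f * (k - (1 / 2 * (3 * ln ?T) + \<delta> / 2 * ln ?T))"
    proof (rule iso)
      have "3 * ?Tt / ?T + \<delta> * ?Ti / ?T = (3 + \<delta>) * ?T / ?T"
        unfolding T_tot_eq by (simp add: add_divide_distrib)
      then show "3 * ?Tt / ?T + \<delta> * ?Ti / ?T = 3 + \<delta>" using Tp by simp
    qed (use Tp in \<open>simp_all add: T_relax_def\<close>)
    \<comment> \<open>Relaxation towards the mean only increases the determinant, for every admissible \<open>\<nu>\<close>.\<close>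
    have "m * (\<Sum>i\<in>UNIV. ln (l i)) \<le> m * (3 * ln ?Tt)"
      using m sum_ln_le_ln_mean[OF l tr] by (intro mult_left_mono) auto
    with key have sl: "(\<Sum>i\<in>UNIV. ln (l i)) \<le> (\<Sum>i\<in>UNIV. ln (s i))"
      by (simp add: algebra_simps)
    have "(\<Sum>i\<in>(UNIV :: 3 set). \<theta> * ln ?T + (1 - \<theta>) * ln (s i)) \<le> (\<Sum>i\<in>UNIV. ln (t i))"
      unfolding t_def using Tp sp assms(3,4) by (intro sum_mono ln_mix) auto
    then have "\<theta> * (3 * ln ?T) + (1 - \<theta>) * (\<Sum>i\<in>UNIV. ln (s i)) \<le> (\<Sum>i\<in>UNIV. ln (t i))"
      by (simp add: sum.distrib sum_distrib_left)
    moreover have "(1 - \<theta>) * (\<Sum>i\<in>UNIV. ln (l i)) \<le> (1 - \<theta>) * (\<Sum>i\<in>UNIV. ln (s i))"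
      using sl assms(4) by (intro mult_left_mono) auto
    moreover have "\<delta> / 2 * (\<theta> * ln ?T + (1 - \<theta>) * ln ?Ti) \<le> \<delta> / 2 * ln (T_relax \<delta> \<theta> f)"
      unfolding T_relax_def using Tp assms(3,4,14) \<delta> by (intro mult_left_mono ln_mix) auto
    ultimately have "\<theta> * (1 / 2 * (3 * ln ?T) + \<delta> / 2 * ln ?T)
        + (1 - \<theta>) * (1 / 2 * (\<Sum>i\<in>UNIV. ln (l i)) + \<delta> / 2 * ln ?Ti)
      \<le> 1 / 2 * (\<Sum>i\<in>UNIV. ln (t i)) + \<delta> / 2 * ln (T_relax \<delta> \<theta> f)"
      by (simp add: field_simps)
    from entropy_interpolation[OF Hl this] rho_pos assms(4)
    have "\<theta> * rel_entropy f (gaussian \<delta> 0 1 f)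
      \<le> H - rho f * (k - (1 / 2 * (\<Sum>i\<in>UNIV. ln (t i)) + \<delta> / 2 * ln (T_relax \<delta> \<theta> f)))"
      unfolding rel by simp
    from mult_left_mono[OF this A] D show ?thesis by (simp add: mult_ac)
  qed
  moreover have "m * ?A * rel_entropy f (gaussian \<delta> 0 0 f) \<le> entropy_production \<delta> \<mu> \<nu> \<theta> f"
    if "\<theta> = 0"
  proof -
    have rel: "rel_entropy f (gaussian \<delta> 0 0 f)
        = H - rho f * (k - (1 / 2 * (3 * ln ?Tt) + \<delta> / 2 * ln ?Ti))"
      using assms(13,14) by (intro iso) (simp_all add: T_relax_def)
    have "t = s" "T_relax \<delta> \<theta> f = ?Ti" using that by (auto simp: t_def T_relax_def)
    note D0 = D[unfolded this]
    have "m * (1 / 2 * (3 * ln ?Tt) + \<delta> / 2 * ln ?Ti)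
        + (1 - m) * (1 / 2 * (\<Sum>i\<in>UNIV. ln (l i)) + \<delta> / 2 * ln ?Ti)
      \<le> 1 / 2 * (\<Sum>i\<in>UNIV. ln (s i)) + \<delta> / 2 * ln ?Ti"
      using key by (simp add: field_simps)
    from entropy_interpolation[OF Hl this] rho_pos m
    have "m * rel_entropy f (gaussian \<delta> 0 0 f)
      \<le> H - rho f * (k - (1 / 2 * (\<Sum>i\<in>UNIV. ln (s i)) + \<delta> / 2 * ln ?Ti))"
      unfolding rel by simp
    from mult_left_mono[OF this A] D0 show ?thesis by (simp add: mult_ac)
  qed
  ultimately show ?thesis unfolding m_def by auto
qed

end
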